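(* For the deformed Askey–Wilson orthogonal polynomial system (see context), $n\ge1$, the coefficients $r_{1\pm},r_{0\pm},p_\pm$ of the deformation matrix elements $\mathfrak R_\pm=r_{1\pm}x+r_{0\pm}$, $\mathfrak P_\pm=p_\pm$ are related to each other and to the spectral parameterisation by $$p_{+}=r_{1+}a_n(v_-)-r_{1-}a_n(v_+),\qquad p_{-}=r_{1+}a_n(v_+)-r_{1-}a_n(v_-),$$ $$r_{0+}=\frac{r_{1+}}{4(q^{1/2}-q^{-1/2})[n]}\left[-w_2(v_+)+w_2(v_-)-2(q^{1/2}-q^{-1/2})(q^{-1/2}\alpha+q^{1/2}\alpha^{-1})(\tilde\sigma_6q^nt-q^{-n}t^{-1})\right],$$ $$r_{0-}=\frac{r_{1-}}{4(q^{1/2}-q^{-1/2})[n]}\left[w_2(v_+)-w_2(v_-)-2(q^{1/2}-q^{-1/2})(q^{-1/2}\alpha+q^{1/2}\alpha^{-1})(\tilde\sigma_6q^nt^{-1}-q^{-n}t)\right],$$ where $w_2(u)$ is the coefficient of $x^2$ in the cubic polynomial $2W_n(x;u)-W(x;u)$.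
   Context: **Lattices.** $x=\tfrac12(z+z^{-1})$, $u=\tfrac12(t+t^{-1})$; $y_\pm=\tfrac12(q^{\pm1/2}z+q^{\mp1/2}z^{-1})$, $\Delta y=y_+-y_-$; $v_\pm=\tfrac12(q^{\pm1/2}t+q^{\mp1/2}t^{-1})$, $\Delta v=v_+-v_-$. Functions of $x$ (resp. $u$) are also regarded as functions of $z$ (resp. $t$). $\mathbb D_xh=(h(y_+)-h(y_-))/\Delta y$, $\mathbb M_xh=\tfrac12(h(y_+)+h(y_-))$, and similarly $\mathbb D_u,\mathbb M_u$ with $v_\pm$. **Parameters.** $a_1,\dots,a_4,\alpha\in\mathbb C$; $a_5=\alpha t$, $a_6=\alpha t^{-1}$. $\tilde\sigma_k$ is the $k$-th elementary symmetric polynomial of $q^{-1/2}a_1,\dots,q^{-1/2}a_6$, so $\tilde\sigma_6=q^{-3}\alpha^2a_1a_2a_3a_4$ is independent of $t$. $[s]:=q^s\tilde\sigma_6-q^{-s}$. Generic conditions: $q\ne1$, $|q^{-1/2}a_j|\neq1$ ($j\le4$), $|q^{-1/2}\alpha|\ne1$, $\alpha\ne0,\pm q^{1/2}$, $t\neq\pm1$, $[n],[n+\frac12]\ne0$. **Weight.** $\omega(x;u)$ is a weight with support $G$ independent of $u$ such that $\omega(y_+;u)/\omega(y_-;u)=\frac{W+\Delta yV}{W-\Delta yV}(x;u)$ and $\omega(x;v_+)/\omega(x;v_-)=\frac{R+\Delta vS}{R-\Delta vS}(x;u)$, where $W,V,R,S$ are the polynomials in $x$ with $W\pm\Delta yV=z^{\mp3}\prod_{j=1}^6(1-q^{-1/2}a_jz^{\pm1})$,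 $R\pm\Delta vS=(1-q^{-1/2}\alpha t^{\pm1}z)(1-q^{-1/2}\alpha t^{\pm1}z^{-1})$. Its Stieltjes function $F(x;u)=\int_G\mathbb Dy\,\frac{\omega(y;u)}{x-y}$ satisfies $W\mathbb D_xF=2V\mathbb M_xF+U$ and $R\,\mathbb D_uF=2S\,\mathbb M_uF+T$ with $U,T$ polynomials in $x$ of degrees $1$ and $0$. ($\int_G\mathbb Dy$ is the lattice integral $\sum_s(\iota_+(x_s)-\iota_-(x_s))h(x_s)$, replaced by a constant multiple of $\int_{-1}^1dy$ in the continuous case.) **OPS.** $p_n(x;u)=\gamma_nx^n+\cdots$ are orthonormal: $\int_G\mathbb Dx\,\omega p_mp_n=\delta_{mn}$. $q_n(x;u)=\int_G\mathbb Dy\,\omega(y;u)\frac{p_n(y;u)}{x-y}$; $a_n=a_n(u)=\gamma_{n-1}/\gamma_n$ denotes the recurrence coefficient in $a_{n+1}p_{n+1}=(x-b_n)p_n-a_np_{n-1}$ (to be distinguished from the parameters $a_1,\dots,a_6$). **Spectral coefficients.** $W_n,\Omega_n$ are the polynomials in $x$ with $2W_n-W\pm\Delta y(\Omega_n+V)=\mathfrak W_\pm$, where $\mathfrak W_+=a_n[(W+\Delta yV)p_n(y_+)q_{n-1}(y_-)-(W-\Delta yV)p_{n-1}(y_-)q_n(y_+)]$, $\mathfrak W_-=a_n[-(W+\Delta yV)p_{n-1}(y_+)q_n(y_-)+(W-\Delta yV)p_n(y_-)q_{n-1}(y_+)]$. **Deformation coefficients** (with decoupling factor $H_n=\frac12a_n$).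 With $p_n^\pm=p_n(x;v_\pm)$, $q_n^\pm=q_n(x;v_\pm)$, the following are polynomials in $x$ of degrees $1,1,0,0$: $\mathfrak R_+=a_n[-(R+\Delta vS)p_n^+q_{n-1}^-+(R-\Delta vS)p_{n-1}^-q_n^+]=r_{1+}x+r_{0+}$, $\mathfrak R_-=a_n[(R+\Delta vS)p_{n-1}^+q_n^--(R-\Delta vS)p_n^-q_{n-1}^+]=r_{1-}x+r_{0-}$, $\mathfrak P_+=-a_n[(R+\Delta vS)p_n^+q_n^--(R-\Delta vS)p_n^-q_n^+]=p_+$, $\mathfrak P_-=a_n[-(R+\Delta vS)p_{n-1}^+q_{n-1}^-+(R-\Delta vS)p_{n-1}^-q_{n-1}^+]=p_-$.
   Formalization: The overall minus sign in the stated definition of 𝔓₋ is dropped, so 𝔓₋ = a_n[−(R+ΔvS)p⁺_{n−1}q⁻_{n−1}+(R−ΔvS)p⁻_{n−1}q⁺_{n−1}]; with the printed sign the formula for p₋ is false whenever p₋≠0. *)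

theory Defs
  imports "HOL-Analysis.Analysis" "HOL-Computational_Algebra.Polynomial"
begin

text \<open>
  Throughout, \<open>qh\<close> stands for a fixed square root of \<open>q\<close>, so that \<open>q = qh\<^sup>2\<close>. Points of the
  \<open>x\<close>-lattice are given by their uniformising variable \<open>z\<close>, those of the \<open>u\<close>-lattice by \<open>t\<close>.
\<close>

section \<open>The Askey--Wilson lattice\<close>

definition lat :: "complex \<Rightarrow> complex" where
  "lat z = (z + inverse z) / 2"

text \<open>The shifted points: \<open>y\<^sub>\<plusminus>\<close> when applied to \<open>z\<close>, and \<open>v\<^sub>\<plusminus>\<close> when applied to \<open>t\<close>.\<close>

definition lat_plus :: "complex \<Rightarrow> complex \<Rightarrow> complex" where
  "lat_plus qh z = lat (qh * z)"

definition lat_minus :: "complex \<Rightarrow> complex \<Rightarrow> complex" where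
  "lat_minus qh z = lat (z / qh)"

definition lat_delta :: "complex \<Rightarrow> complex \<Rightarrow> complex" where
  "lat_delta qh z = lat_plus qh z - lat_minus qh z"

definition div_diff :: "complex \<Rightarrow> (complex \<Rightarrow> complex) \<Rightarrow> complex \<Rightarrow> complex" where
  "div_diff qh h z = (h (lat_plus qh z) - h (lat_minus qh z)) / lat_delta qh z"

definition mean_op :: "complex \<Rightarrow> (complex \<Rightarrow> complex) \<Rightarrow> complex \<Rightarrow> complex" where
  "mean_op qh h z = (h (lat_plus qh z) + h (lat_minus qh z)) / 2"

section \<open>Supports and the lattice integral\<close>

text \<open>
  A support is either a set of points \<open>x\<^sub>s = lat (z\<^sub>0 q\<^sup>s)\<close>, \<open>s \<in> S\<close>, of a direct lattice with base
  point \<open>z\<^sub>0\<close>, or the interval \<open>[-1, 1]\<close>; in the latter case the lattice integral is \<open>c\<close> times the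
  Lebesgue integral.

  Integrands are functions of \<open>z\<close> rather than of \<open>x\<close>: an Askey--Wilson weight carries a factor
  \<open>1 / sqrt (1 - x\<^sup>2) = 2 * \<i> / (z - 1/z)\<close>, which is single-valued only as a function of \<open>z\<close>.
  On the interval, \<open>y = cos \<theta>\<close> is represented by \<open>z = exp (\<i> * \<theta>)\<close> with \<open>0 \<le> \<theta> \<le> \<pi>\<close>.
\<close>

datatype support = Lattice complex "int set" | Interval complex

fun support_ok :: "support \<Rightarrow> bool" where
  "support_ok (Lattice z0 S) \<longleftrightarrow> z0 \<noteq> 0"
| "support_ok (Interval c) \<longleftrightarrow> True"

definition lattice_node :: "complex \<Rightarrow> complex \<Rightarrow> int \<Rightarrow> complex" where
  "lattice_node qh z0 s = z0 * (qh\<^sup>2) powi s"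

definition circle_node :: "real \<Rightarrow> complex" where
  "circle_node y = Complex y (sqrt (1 - y\<^sup>2))"

fun support_points :: "complex \<Rightarrow> support \<Rightarrow> complex set" where
  "support_points qh (Lattice z0 S) = (\<lambda>s. lat (lattice_node qh z0 s)) ` S"
| "support_points qh (Interval c) = complex_of_real ` {-1..1}"

fun lat_integrable :: "complex \<Rightarrow> support \<Rightarrow> (complex \<Rightarrow> complex) \<Rightarrow> bool" where
  "lat_integrable qh (Lattice z0 S) h \<longleftrightarrow>
     (\<lambda>s. lat_delta qh (lattice_node qh z0 s) * h (lattice_node qh z0 s)) summable_on S"
| "lat_integrable qh (Interval c) h \<longleftrightarrow>
     set_integrable lborel {-1..1} (\<lambda>y::real. h (circle_node y))"

fun lat_integral :: "complex \<Rightarrow> support \<Rightarrow> (complex \<Rightarrow> complex) \<Rightarrow> complex" where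
  "lat_integral qh (Lattice z0 S) h =
     (\<Sum>\<^sub>\<infinity>s\<in>S. lat_delta qh (lattice_node qh z0 s) * h (lattice_node qh z0 s))"
| "lat_integral qh (Interval c) h =
     c * set_lebesgue_integral lborel {-1..1} (\<lambda>y::real. h (circle_node y))"

section \<open>Parameters\<close>

definition params :: "(nat \<Rightarrow> complex) \<Rightarrow> complex \<Rightarrow> complex \<Rightarrow> nat \<Rightarrow> complex" where
  "params a \<alpha> t j = (if j = 5 then \<alpha> * t else if j = 6 then \<alpha> / t else a j)"

text \<open>The elementary symmetric polynomials of \<open>a\<^sub>1 / qh, \<dots>, a\<^sub>6 / qh\<close>.\<close>

definition param_esym :: "complex \<Rightarrow> (nat \<Rightarrow> complex) \<Rightarrow> complex \<Rightarrow> complex \<Rightarrow> nat \<Rightarrow> complex" where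
  "param_esym qh a \<alpha> t k =
     (\<Sum>X | X \<subseteq> {1..6} \<and> card X = k. \<Prod>j\<in>X. params a \<alpha> t j / qh)"

lemma param_esym_6:
  assumes "t \<noteq> 0"
  shows "param_esym qh a \<alpha> t 6 = \<alpha>\<^sup>2 * a 1 * a 2 * a 3 * a 4 / qh ^ 6"
proof -
  have eq: "{X. X \<subseteq> {1..6::nat} \<and> card X = 6} = {{1..6}}"
  proof (intro set_eqI iffI)
    fix X :: "nat set"
    assume "X \<in> {X. X \<subseteq> {1..6} \<and> card X = 6}"
    then show "X \<in> {{1..6}}"
      using card_subset_eq[of "{1..6::nat}" X] by auto
  qed auto
  have s: "{1..6::nat} = {1,2,3,4,5,6}"
    by auto
  show ?thesis
    unfolding param_esym_def eq unfolding s
    using assms by (simp add: params_def field_simps power2_eq_square power_eq_if)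
qed

text \<open>
  The bracket \<open>[s] = q\<^sup>s \<sigma>\<^sub>6 - q\<^sup>-\<^sup>s\<close> for half-integral \<open>s\<close>. The argument \<open>k\<close> is \<open>2 * s\<close>, so that
  \<open>[n]\<close> is the bracket at \<open>k = 2 * n\<close> and \<open>[n + 1/2]\<close> the one at \<open>k = 2 * n + 1\<close>.
\<close>

definition bracket :: "complex \<Rightarrow> complex \<Rightarrow> nat \<Rightarrow> complex" where
  "bracket qh \<sigma>\<^sub>6 k = qh ^ k * \<sigma>\<^sub>6 - inverse (qh ^ k)"

section \<open>Spectral and deformation data polynomials\<close>

definition spectral_data ::
  "complex \<Rightarrow> (nat \<Rightarrow> complex) \<Rightarrow> complex \<Rightarrow> complex \<Rightarrow> complex poly \<Rightarrow> complex poly \<Rightarrow> bool" where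
  "spectral_data qh a \<alpha> t W V \<longleftrightarrow>
     (\<forall>z. z \<noteq> 0 \<longrightarrow>
        poly W (lat z) + lat_delta qh z * poly V (lat z) =
          inverse z ^ 3 * (\<Prod>j=1..6. 1 - params a \<alpha> t j / qh * z) \<and>
        poly W (lat z) - lat_delta qh z * poly V (lat z) =
          z ^ 3 * (\<Prod>j=1..6. 1 - params a \<alpha> t j / qh * inverse z))"

definition deformation_data ::
  "complex \<Rightarrow> complex \<Rightarrow> complex \<Rightarrow> complex poly \<Rightarrow> complex poly \<Rightarrow> bool" where
  "deformation_data qh \<alpha> t R S \<longleftrightarrow>
     (\<forall>z. z \<noteq> 0 \<longrightarrow>
        poly R (lat z) + lat_delta qh t * poly S (lat z) =
          (1 - \<alpha> / qh * t * z) * (1 - \<alpha> / qh * t * inverse z) \<and>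
        poly R (lat z) - lat_delta qh t * poly S (lat z) =
          (1 - \<alpha> / qh * inverse t * z) * (1 - \<alpha> / qh * inverse t * inverse z))"

section \<open>The weight and its Stieltjes function\<close>

text \<open>
  A weight is a function of \<open>z\<close> and \<open>u\<close>. The guards leave out poles and zeros; a weight on a discrete
  support is extended by zero.
\<close>

definition pearson_x ::
  "complex \<Rightarrow> (complex \<Rightarrow> complex \<Rightarrow> complex) \<Rightarrow> complex \<Rightarrow> complex poly \<Rightarrow> complex poly \<Rightarrow> bool" where
  "pearson_x qh \<omega> u W V \<longleftrightarrow>
     (\<forall>z. z \<noteq> 0 \<longrightarrow> \<omega> (z / qh) u \<noteq> 0 \<longrightarrow>
        poly W (lat z) - lat_delta qh z * poly V (lat z) \<noteq> 0 \<longrightarrow>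
        \<omega> (qh * z) u / \<omega> (z / qh) u =
          (poly W (lat z) + lat_delta qh z * poly V (lat z)) /
          (poly W (lat z) - lat_delta qh z * poly V (lat z)))"

definition pearson_u ::
  "complex \<Rightarrow> (complex \<Rightarrow> complex \<Rightarrow> complex) \<Rightarrow> complex \<Rightarrow> complex poly \<Rightarrow> complex poly \<Rightarrow> bool" where
  "pearson_u qh \<omega> t R S \<longleftrightarrow>
     (\<forall>z. z \<noteq> 0 \<longrightarrow> \<omega> z (lat_minus qh t) \<noteq> 0 \<longrightarrow>
        poly R (lat z) - lat_delta qh t * poly S (lat z) \<noteq> 0 \<longrightarrow>
        \<omega> z (lat_plus qh t) / \<omega> z (lat_minus qh t) =
          (poly R (lat z) + lat_delta qh t * poly S (lat z)) /
          (poly R (lat z) - lat_delta qh t * poly S (lat z)))"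

definition stieltjes ::
  "complex \<Rightarrow> support \<Rightarrow> (complex \<Rightarrow> complex \<Rightarrow> complex) \<Rightarrow> complex \<Rightarrow> complex \<Rightarrow> complex" where
  "stieltjes qh G \<omega> x u = lat_integral qh G (\<lambda>z. \<omega> z u / (x - lat z))"

text \<open>
  The identities below that involve functions defined by Cauchy-type integrals over the support are
  imposed for large arguments off the support. On an interval the \<open>x\<close>-difference equation (and with
  it the spectral coefficients) is an identity of analytic continuations from infinity, and does not
  hold literally when \<open>qh * z\<close> and \<open>z / qh\<close> are separated by the unit circle.
\<close>

definition stieltjes_eq_x ::
  "complex \<Rightarrow> support \<Rightarrow> (complex \<Rightarrow> complex \<Rightarrow> complex) \<Rightarrow> complex \<Rightarrow>
     complex poly \<Rightarrow> complex poly \<Rightarrow> bool" where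
  "stieltjes_eq_x qh G \<omega> u W V \<longleftrightarrow>
     (\<exists>U :: complex poly. degree U \<le> 1 \<and>
        (\<forall>\<^sub>F z in at_infinity.
           lat_plus qh z \<notin> support_points qh G \<longrightarrow> lat_minus qh z \<notin> support_points qh G \<longrightarrow>
           poly W (lat z) * div_diff qh (\<lambda>x. stieltjes qh G \<omega> x u) z =
             2 * poly V (lat z) * mean_op qh (\<lambda>x. stieltjes qh G \<omega> x u) z + poly U (lat z)))"

definition stieltjes_eq_u ::
  "complex \<Rightarrow> support \<Rightarrow> (complex \<Rightarrow> complex \<Rightarrow> complex) \<Rightarrow> complex \<Rightarrow>
     complex poly \<Rightarrow> complex poly \<Rightarrow> bool" where
  "stieltjes_eq_u qh G \<omega> t R S \<longleftrightarrow>
     (\<exists>T :: complex poly. degree T = 0 \<and>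
        (\<forall>\<^sub>F x in at_infinity.
           x \<notin> support_points qh G \<longrightarrow>
           poly R x * div_diff qh (\<lambda>u. stieltjes qh G \<omega> x u) t =
             2 * poly S x * mean_op qh (\<lambda>u. stieltjes qh G \<omega> x u) t + poly T x))"

section \<open>Orthonormal polynomials and functions of the second kind\<close>

text \<open>
  Orthonormality is required up to index \<open>n\<close> only, since a finite support carries only finitely
  many orthonormal polynomials.
\<close>

definition orthonormal_upto ::
  "complex \<Rightarrow> support \<Rightarrow> (complex \<Rightarrow> complex \<Rightarrow> complex) \<Rightarrow>
     (nat \<Rightarrow> complex \<Rightarrow> complex poly) \<Rightarrow> nat \<Rightarrow> complex \<Rightarrow> bool" where
  "orthonormal_upto qh G \<omega> p n u \<longleftrightarrow>
     (\<forall>k. lat_integrable qh G (\<lambda>z. \<omega> z u * lat z ^ k)) \<and>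
     (\<forall>i\<le>n. p i u \<noteq> 0 \<and> degree (p i u) = i) \<and>
     (\<forall>i\<le>n. \<forall>j\<le>n.
        lat_integral qh G (\<lambda>z. \<omega> z u * poly (p i u) (lat z) * poly (p j u) (lat z)) =
          (if i = j then 1 else 0))"

definition second_kind ::
  "complex \<Rightarrow> support \<Rightarrow> (complex \<Rightarrow> complex \<Rightarrow> complex) \<Rightarrow>
     (nat \<Rightarrow> complex \<Rightarrow> complex poly) \<Rightarrow> nat \<Rightarrow> complex \<Rightarrow> complex \<Rightarrow> complex" where
  "second_kind qh G \<omega> p n x u =
     lat_integral qh G (\<lambda>z. \<omega> z u * (poly (p n u) (lat z) / (x - lat z)))"

definition rec_coeff :: "(nat \<Rightarrow> complex \<Rightarrow> complex poly) \<Rightarrow> nat \<Rightarrow> complex \<Rightarrow> complex" where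
  "rec_coeff p n u = lead_coeff (p (n - 1) u) / lead_coeff (p n u)"

section \<open>Spectral coefficients\<close>

definition spectral_coeffs ::
  "complex \<Rightarrow> support \<Rightarrow> (complex \<Rightarrow> complex \<Rightarrow> complex) \<Rightarrow>
     (nat \<Rightarrow> complex \<Rightarrow> complex poly) \<Rightarrow> nat \<Rightarrow> complex \<Rightarrow>
     complex poly \<Rightarrow> complex poly \<Rightarrow> complex poly \<Rightarrow> complex poly \<Rightarrow> bool" where
  "spectral_coeffs qh G \<omega> p n u W V Wn \<Omega>n \<longleftrightarrow>
     (\<forall>\<^sub>F z in at_infinity.
        let x = lat z; yp = lat_plus qh z; ym = lat_minus qh z; dy = lat_delta qh z;
            wp = poly W x + dy * poly V x; wm = poly W x - dy * poly V x;
            P = (\<lambda>k y. poly (p k u) y); Q = (\<lambda>k y. second_kind qh G \<omega> p k y u)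
        in yp \<notin> support_points qh G \<longrightarrow> ym \<notin> support_points qh G \<longrightarrow>
           2 * poly Wn x - poly W x + dy * (poly \<Omega>n x + poly V x) =
             rec_coeff p n u * (wp * P n yp * Q (n - 1) ym - wm * P (n - 1) ym * Q n yp) \<and>
           2 * poly Wn x - poly W x - dy * (poly \<Omega>n x + poly V x) =
             rec_coeff p n u * (- wp * P (n - 1) yp * Q n ym + wm * P n ym * Q (n - 1) yp))"

section \<open>Deformation coefficients\<close>

text \<open>
  These are the matrix elements of the transfer matrix (\<open>\<RR>\<^sub>+\<close>, \<open>-\<PP>\<^sub>+\<close>; \<open>\<PP>\<^sub>-\<close>, \<open>\<RR>\<^sub>-\<close>) in the
  \<open>u\<close>-direction, scaled by the decoupling factor: multiplied by \<open>-1 / a\<^sub>n\<close> it is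
  \<open>Y(v\<^sub>+) * diag (R + \<Delta>v S, R - \<Delta>v S) * adj (Y(v\<^sub>-))\<close> for \<open>Y\<close> with rows \<open>(p\<^sub>n, q\<^sub>n)\<close> and
  \<open>(p\<^sub>n\<^sub>-\<^sub>1, q\<^sub>n\<^sub>-\<^sub>1)\<close>. This fixes the sign of \<open>\<PP>\<^sub>-\<close> as
  \<open>a\<^sub>n * (- (R + \<Delta>v S) * p\<^sub>n\<^sub>-\<^sub>1(v\<^sub>+) * q\<^sub>n\<^sub>-\<^sub>1(v\<^sub>-) + \<dots>)\<close>; the opposite sign, which also occurs in the
  source, is incompatible with \<open>\<PP>\<^sub>- = r\<^sub>1\<^sub>+ a\<^sub>n(v\<^sub>+) - r\<^sub>1\<^sub>- a\<^sub>n(v\<^sub>-)\<close>.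
  The prefactor \<open>a\<^sub>n\<close> is taken at \<open>u = lat t\<close>.
\<close>

definition deformation_coeffs ::
  "complex \<Rightarrow> support \<Rightarrow> (complex \<Rightarrow> complex \<Rightarrow> complex) \<Rightarrow>
     (nat \<Rightarrow> complex \<Rightarrow> complex poly) \<Rightarrow> nat \<Rightarrow> complex \<Rightarrow> complex poly \<Rightarrow> complex poly \<Rightarrow>
     complex \<Rightarrow> complex \<Rightarrow> complex \<Rightarrow> complex \<Rightarrow> complex \<Rightarrow> complex \<Rightarrow> bool" where
  "deformation_coeffs qh G \<omega> p n t R S r1p r0p r1m r0m pp pm \<longleftrightarrow>
     (\<forall>\<^sub>F x in at_infinity.
        let an = rec_coeff p n (lat t); vp = lat_plus qh t; vm = lat_minus qh t;
            Rp = poly R x + lat_delta qh t * poly S x; Rm = poly R x - lat_delta qh t * poly S x;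
            P = (\<lambda>k v. poly (p k v) x); Q = (\<lambda>k v. second_kind qh G \<omega> p k x v)
        in x \<notin> support_points qh G \<longrightarrow>
           an * (- Rp * P n vp * Q (n - 1) vm + Rm * P (n - 1) vm * Q n vp) = r1p * x + r0p \<and>
           an * (Rp * P (n - 1) vp * Q n vm - Rm * P n vm * Q (n - 1) vp) = r1m * x + r0m \<and>
           - an * (Rp * P n vp * Q n vm - Rm * P n vm * Q n vp) = pp \<and>
           an * (- Rp * P (n - 1) vp * Q (n - 1) vm + Rm * P (n - 1) vm * Q (n - 1) vp) = pm)"

text \<open>The coefficient \<open>w\<^sub>2\<close> of \<open>x\<^sup>2\<close> in \<open>2 W\<^sub>n - W\<close>.\<close>

definition w2 ::
  "(complex \<Rightarrow> complex poly) \<Rightarrow> (complex \<Rightarrow> complex poly) \<Rightarrow> complex \<Rightarrow> complex" where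
  "w2 Wn W u = coeff (2 * Wn u - W u) 2"

end

theory Submission
  imports Defs
begin

text \<open>
  Everything is read off from the first two terms of the expansions at infinity. Write
  \<open>p\<^sub>n = \<gamma>\<^sub>n (x\<^sup>n + \<pi>\<^sub>n x\<^sup>n\<^sup>-\<^sup>1 + \<dots>)\<close>. Orthonormality gives \<open>q\<^sub>n = x\<^sup>-\<^sup>n\<^sup>-\<^sup>1 / \<gamma>\<^sub>n (1 + O(1/x))\<close> and
  \<open>q\<^sub>n\<^sub>-\<^sub>1 = x\<^sup>-\<^sup>n / \<gamma>\<^sub>n\<^sub>-\<^sub>1 (1 - \<pi>\<^sub>n / x + \<dots>)\<close>. Inserted into the spectral coefficients this yields
  \<open>w\<^sub>2 = - 4 (q\<^sup>1\<^sup>/\<^sup>2 - q\<^sup>-\<^sup>1\<^sup>/\<^sup>2) [n] \<pi>\<^sub>n - 2 (q\<^sup>n \<sigma>\<^sub>5 + q\<^sup>-\<^sup>n \<sigma>\<^sub>1)\<close>, where \<open>\<sigma>\<^sub>1, \<sigma>\<^sub>5\<close> are affine in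
  \<open>t + 1/t\<close>. Inserted into the deformation coefficients, with \<open>\<beta> = q\<^sup>-\<^sup>1\<^sup>/\<^sup>2 \<alpha>\<close>, it expresses
  \<open>r\<^sub>1\<^sub>\<plusminus>\<close> and \<open>p\<^sub>\<plusminus>\<close> by the \<open>\<gamma>\<close>s and gives
  \<open>r\<^sub>0\<^sub>+ = r\<^sub>1\<^sub>+ (\<pi>\<^sub>n(v\<^sub>+) - \<pi>\<^sub>n(v\<^sub>-) - (1 + \<beta>\<^sup>2 t\<^sup>2) / (2 \<beta> t))\<close>; the formula for \<open>r\<^sub>0\<^sub>-\<close> arises from
  \<open>t \<mapsto> 1/t\<close>. Eliminating \<open>\<pi>\<^sub>n\<close> gives the claim.

  The support may be unbounded and accumulate at infinity, where the expansions of \<open>q\<^sub>n\<close> fail near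
  the support. They are therefore taken along a filter on which the relative distance of \<open>y\<^sub>\<plusminus>\<close> to
  the support is bounded below.
\<close>

section \<open>Approaching infinity away from the support\<close>

text \<open>The bound is relative to \<open>norm x\<close>, so that the Cauchy kernel is O(1/x)
  uniformly over the support, even over an unbounded one.\<close>

definition separated :: "real \<Rightarrow> complex set \<Rightarrow> complex \<Rightarrow> bool" where
  "separated c X x \<longleftrightarrow> (\<forall>y\<in>X. c * norm x \<le> norm (x - y))"

lemma separated_notin: "separated c X x \<Longrightarrow> c > 0 \<Longrightarrow> x \<noteq> 0 \<Longrightarrow> x \<notin> X"
  by (auto simp: separated_def mult_le_0_iff)

lemma eventually_separated_bounded:
  assumes "bounded X"
  shows "\<forall>\<^sub>F x in at_infinity. separated (1/2) X x"
proof -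
  obtain B where B: "\<And>y. y \<in> X \<Longrightarrow> norm y \<le> B"
    using assms by (auto simp: bounded_iff)
  have "separated (1/2) X x" if "norm x \<ge> 2 * B" for x
    unfolding separated_def
  proof
    fix y assume "y \<in> X"
    then show "1 / 2 * norm x \<le> norm (x - y)"
      using B[of y] norm_triangle_ineq2[of x y] that by simp
  qed
  then show ?thesis by (auto simp: eventually_at_infinity)
qed

lemma filterlim_lat_at_infinity:
  assumes "filterlim f at_infinity F"
  shows "filterlim (\<lambda>z. lat (f z)) at_infinity F"
proof -
  have "((\<lambda>z. inverse (f z)) \<longlongrightarrow> 0) F"
    using filterlim_compose[OF tendsto_inverse_0 assms] by simp
  then have "filterlim (\<lambda>z. inverse (f z) + f z) at_infinity F"
    by (rule tendsto_add_filterlim_at_infinity) (rule assms)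
  then have "filterlim (\<lambda>z. (1/2) * (inverse (f z) + f z)) at_infinity F"
    by (intro tendsto_mult_filterlim_at_infinity[where c = "1/2"]) auto
  then show ?thesis by (simp add: lat_def field_simps)
qed

lemma filterlim_cmult_at_infinity:
  fixes k :: complex
  assumes "k \<noteq> 0" "filterlim f at_infinity F"
  shows "filterlim (\<lambda>z. k * f z) at_infinity F"
  using assms by (intro tendsto_mult_filterlim_at_infinity[where c = k]) auto

lemma norm_lat_le: "norm z \<ge> 1 \<Longrightarrow> norm (lat z) \<le> norm z"
proof -
  assume z: "norm z \<ge> 1"
  then have "inverse (norm z) \<le> 1" by (simp add: inverse_le_1_iff)
  then have "norm (inverse z) \<le> norm z" using z by (simp add: norm_inverse)
  then show ?thesis
    using norm_triangle_ineq[of z "inverse z"] by (simp add: lat_def)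
qed

lemma lat_diff: "z \<noteq> 0 \<Longrightarrow> w \<noteq> 0 \<Longrightarrow> lat z - lat w = (z - w) * (1 - inverse (z * w)) / 2"
  by (simp add: lat_def field_simps)

text \<open>\<open>lat\<close> identifies \<open>w\<close> with its inverse, so the difference
  factors through \<open>z - w\<close> and \<open>1 - inverse (z * w)\<close>. Both factors are
  bounded below by moduli alone; the phases of the nodes do not matter.\<close>

lemma lat_diff_lower_bound:
  assumes "norm z \<ge> 1" "w \<noteq> 0" "0 \<le> \<delta>" "0 \<le> \<epsilon>"
    and "\<delta> \<le> \<bar>norm w / norm z - 1\<bar>" "\<epsilon> \<le> \<bar>1 / (norm z * norm w) - 1\<bar>"
  shows "\<delta> * \<epsilon> / 2 * norm (lat z) \<le> norm (lat z - lat w)"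
proof -
  have z: "z \<noteq> 0" using assms(1) by auto
  have "\<delta> * norm z \<le> \<bar>norm w / norm z - 1\<bar> * norm z"
    using assms by (intro mult_right_mono) auto
  also have "\<dots> = \<bar>norm z - norm w\<bar>"
    using z by (subst abs_mult_pos) (auto simp: left_diff_distrib abs_minus_commute)
  also have "\<dots> \<le> norm (z - w)" by (rule norm_triangle_ineq3)
  finally have 1: "\<delta> * norm z \<le> norm (z - w)" .
  have "\<epsilon> \<le> \<bar>norm (1::complex) - norm (inverse (z * w))\<bar>"
    using assms by (simp add: norm_inverse norm_mult divide_inverse abs_minus_commute)
  also have "\<dots> \<le> norm (1 - inverse (z * w))" by (rule norm_triangle_ineq3)
  finally have 2: "\<epsilon> \<le> norm (1 - inverse (z * w))" .
  have "(\<delta> * norm (lat z)) * \<epsilon> \<le> (\<delta> * norm z) * \<epsilon>"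
    using assms norm_lat_le[of z] by (intro mult_right_mono mult_left_mono) auto
  also have "\<dots> \<le> norm (z - w) * norm (1 - inverse (z * w))"
    using 1 2 assms by (intro mult_mono) auto
  finally show ?thesis
    using z assms(2) by (simp add: lat_diff norm_mult norm_divide mult_ac)
qed

text \<open>A geometric progression is monotone, so no term comes closer to 1 than the nearer of the
  two consecutive terms that enclose it.\<close>

lemma powi_gap_greater:
  fixes R \<nu> :: real
  assumes "R > 1" "\<nu> > 0" "\<And>j. \<nu> * R powi j \<noteq> 1"
  shows "\<exists>\<delta>>0. \<forall>j. \<delta> \<le> \<bar>\<nu> * R powi j - 1\<bar>"
proof -
  \<comment> \<open>With this \<open>i\<close> the progression crosses 1 between the indices
    \<open>- i - 1\<close> and \<open>- i\<close>.\<close>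
  define i where "i = \<lfloor>log R \<nu>\<rfloor>"
  have "R powr (real_of_int i) \<le> \<nu>" "\<nu> < R powr (real_of_int (i + 1))"
    using assms by (simp_all only: le_log_iff[symmetric] log_less_iff[symmetric])
      (auto simp: i_def)
  then have "R powi i \<le> \<nu>" "\<nu> < R powi (i + 1)"
    using assms powr_real_of_int'[of R i] powr_real_of_int'[of R "i + 1"] by (auto simp del: of_int_add)
  then have lo: "\<nu> * R powi (- i) \<ge> 1" and hi: "\<nu> * R powi (- i - 1) < 1"
    using assms(1,2) by (simp_all add: power_int_minus power_int_add power_int_diff field_simps)
  have lo': "\<nu> * R powi (- i) > 1" using lo assms(3)[of "- i"] by linarith
  define \<delta> where "\<delta> = min (\<nu> * R powi (- i) - 1) (1 - \<nu> * R powi (- i - 1))"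
  have "\<delta> \<le> \<bar>\<nu> * R powi j - 1\<bar>" for j
  proof (cases "j \<ge> - i")
    case True
    then have "\<nu> * R powi (- i) \<le> \<nu> * R powi j"
      using assms by (intro mult_left_mono power_int_increasing) auto
    then show ?thesis unfolding \<delta>_def by linarith
  next
    case False
    then have "\<nu> * R powi j \<le> \<nu> * R powi (- i - 1)"
      using assms by (intro mult_left_mono power_int_increasing) auto
    then show ?thesis unfolding \<delta>_def by linarith
  qed
  moreover have "\<delta> > 0" using lo' hi by (simp add: \<delta>_def)
  ultimately show ?thesis by blast
qed

lemma powi_gap:
  fixes R \<nu> :: real
  assumes "R > 0" "R \<noteq> 1" "\<nu> > 0" "\<And>j. \<nu> * R powi j \<noteq> 1"
  shows "\<exists>\<delta>>0. \<forall>j. \<delta> \<le> \<bar>\<nu> * R powi j - 1\<bar>"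
proof (cases "R > 1")
  case True
  then show ?thesis using assms powi_gap_greater by blast
next
  case False
  then have "inverse R > 1" using assms by (simp add: one_less_inverse)
  moreover have "\<nu> * inverse R powi j \<noteq> 1" for j
    using assms(4)[of "- j"] by (simp add: power_int_minus power_int_inverse)
  ultimately obtain \<delta> where \<delta>: "\<delta> > 0" "\<And>j. \<delta> \<le> \<bar>\<nu> * inverse R powi j - 1\<bar>"
    using powi_gap_greater[of "inverse R" \<nu>] assms by auto
  have "\<delta> \<le> \<bar>\<nu> * R powi j - 1\<bar>" for j
    using \<delta>(2)[of "- j"] by (simp add: power_int_minus power_int_inverse)
  then show ?thesis using \<delta>(1) by blast
qed

text \<open>One filter has to serve both shifted points, because the spectral coefficients mix
  values at y_+ and y_-. For a bounded support \<open>at_infinity\<close> itself will do; otherwise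
  the support is a lattice with |q| different from 1.\<close>

lemma ex_separating_filter:
  assumes G: "support_ok G" and q: "qh \<noteq> 0"
  obtains F c where "F \<noteq> bot" "F \<le> at_infinity" "c > 0"
    "\<forall>\<^sub>F z in F. separated c (support_points qh G) (lat_plus qh z)"
    "\<forall>\<^sub>F z in F. separated c (support_points qh G) (lat_minus qh z)"
proof (cases "bounded (support_points qh G)")
  case True
  have id: "filterlim (\<lambda>z::complex. z) at_infinity at_infinity" by (simp add: filterlim_ident)
  have "filterlim (\<lambda>z. lat (qh * z)) at_infinity at_infinity"
    "filterlim (\<lambda>z. lat (inverse qh * z)) at_infinity at_infinity"
    using q by (auto intro!: filterlim_lat_at_infinity filterlim_cmult_at_infinity id)
  then have "filterlim (lat_plus qh) at_infinity at_infinity"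
    "filterlim (lat_minus qh) at_infinity at_infinity"
    by (simp_all add: lat_plus_def[abs_def] lat_minus_def[abs_def] divide_inverse mult.commute)
  then have "\<forall>\<^sub>F z in at_infinity. separated (1/2) (support_points qh G) (lat_plus qh z)"
    "\<forall>\<^sub>F z in at_infinity. separated (1/2) (support_points qh G) (lat_minus qh z)"
    using eventually_separated_bounded[OF True] by (auto elim: eventually_compose_filterlim)
  then show ?thesis
    using that[OF trivial_limit_at_infinity order_refl, of "1/2"] by simp
next
  case unbdd: False
  obtain z0 S where GL: "G = Lattice z0 S" and z0: "z0 \<noteq> 0"
  proof (cases G)
    case (Interval c)
    have "bounded (complex_of_real ` {-1..1})"
      by (intro compact_imp_bounded compact_continuous_image continuous_intros) auto
    then show ?thesis using unbdd Interval by simp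
  qed (use G in auto)
  define r where "r = norm qh"
  define R where "R = r\<^sup>2"
  have r0: "r > 0" and R0: "R > 0" using q by (auto simp: r_def R_def)
  have norm_node: "norm (lattice_node qh z0 s) = norm z0 * R powi s" for s
    by (simp add: lattice_node_def norm_mult norm_power_int norm_power R_def r_def)
  \<comment> \<open>If |q| = 1, all nodes have modulus \<open>norm z0\<close> and \<open>lat\<close>
    is bounded on them, contrary to \<open>unbdd\<close>.\<close>
  have R1: "R \<noteq> 1"
  proof
    assume "R = 1"
    then have "norm (lattice_node qh z0 s) = norm z0" for s using norm_node by simp
    then have "norm (lat (lattice_node qh z0 s)) \<le> (norm z0 + inverse (norm z0)) / 2" for s
      using norm_triangle_ineq[of "lattice_node qh z0 s" "inverse (lattice_node qh z0 s)"] z0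
      by (simp add: lat_def norm_inverse norm_divide)
    then have "bounded (support_points qh G)"
      unfolding GL bounded_iff by (intro exI[of _ "(norm z0 + inverse (norm z0)) / 2"]) auto
    then show False using unbdd by simp
  qed
  txt \<open>
    Nodes with large \<open>lat w\<close> have modulus near \<open>\<bar>z\<^sub>0\<bar> R\<^sup>s\<close> or, for small \<open>w\<close>, the reciprocal of it. So \<open>z\<close>
    runs through a geometric sequence with ratio \<open>R\<close> whose starting point avoids the countable set
    of resonances with both progressions.
  \<close>
  define E where "E = range (\<lambda>j. norm z0 / r * R powi j) \<union> range (\<lambda>j. 1 / (norm z0 * r) * R powi j)"
  have "countable E" unfolding E_def by simp
  then have "\<not> {1<..<2} \<subseteq> E"
    using uncountable_open_interval[of 1 "2::real"] countable_subset by auto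
  then obtain \<mu> where \<mu>: "\<mu> > 0" "\<mu> \<notin> E" by force
  have "norm z0 / (\<mu> * r) * R powi j \<noteq> 1" for j
  proof
    assume "norm z0 / (\<mu> * r) * R powi j = 1"
    then have "\<mu> = norm z0 / r * R powi j" using \<mu>(1) r0 by (simp add: field_simps)
    then show False using \<mu>(2) unfolding E_def by blast
  qed
  then obtain \<delta> where \<delta>: "\<delta> > 0" "\<And>j. \<delta> \<le> \<bar>norm z0 / (\<mu> * r) * R powi j - 1\<bar>"
    using powi_gap[of R "norm z0 / (\<mu> * r)"] R0 R1 \<mu>(1) r0 z0 by auto
  have "1 / (norm z0 * \<mu> * r) * R powi j \<noteq> 1" for j
  proof
    assume "1 / (norm z0 * \<mu> * r) * R powi j = 1"
    then have "\<mu> = 1 / (norm z0 * r) * R powi j" using \<mu>(1) r0 z0 by (simp add: field_simps)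
    then show False using \<mu>(2) unfolding E_def by blast
  qed
  then obtain \<epsilon> where \<epsilon>: "\<epsilon> > 0" "\<And>j. \<epsilon> \<le> \<bar>1 / (norm z0 * \<mu> * r) * R powi j - 1\<bar>"
    using powi_gap[of R "1 / (norm z0 * \<mu> * r)"] R0 R1 \<mu>(1) r0 z0 by auto
  \<comment> \<open>The sign makes the sequence run to infinity whether |q| is above or below
    1.\<close>
  define sg :: int where "sg = (if R > 1 then 1 else - 1)"
  define f where "f = (\<lambda>k::nat. complex_of_real (\<mu> * R powi (sg * int k)))"
  have grow: "filterlim f at_infinity sequentially"
  proof -
    define b where "b = R powi sg"
    have "b > 1" using R0 R1 by (auto simp: b_def sg_def power_int_minus one_less_inverse)
    then have "filterlim (\<lambda>k. complex_of_real b ^ k) at_infinity sequentially"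
      by (intro filterlim_realpow_sequentially_gt1) simp
    then have "filterlim (\<lambda>k. complex_of_real \<mu> * complex_of_real b ^ k) at_infinity sequentially"
      using \<mu>(1) by (intro filterlim_cmult_at_infinity) auto
    moreover have "f = (\<lambda>k. complex_of_real \<mu> * complex_of_real b ^ k)"
      by (simp add: f_def b_def power_int_mult fun_eq_iff)
    ultimately show ?thesis by simp
  qed
  \<comment> \<open>Multiplication by \<open>qh\<close> changes a modulus by the factor
    \<open>r\<close>, division by \<open>qh\<close> by \<open>r / R\<close>. Both shifted arguments
    thus have modulus \<open>\<mu> * r * R powi j\<close>, and one claim covers y_+ and y_-.\<close>
  have sep: "separated (\<delta> * \<epsilon> / 2) (support_points qh G) (lat \<zeta>)"
    if \<zeta>: "norm \<zeta> \<ge> 1" "norm \<zeta> = \<mu> * r * R powi j" for \<zeta> j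
    unfolding separated_def GL
  proof
    fix y assume "y \<in> support_points qh (Lattice z0 S)"
    then obtain s where y: "y = lat (lattice_node qh z0 s)" by auto
    let ?w = "lattice_node qh z0 s"
    have w: "?w \<noteq> 0" using z0 q by (simp add: lattice_node_def)
    have 1: "norm ?w / norm \<zeta> = norm z0 / (\<mu> * r) * R powi (s - j)"
      using R0 by (simp add: norm_node \<zeta>(2) power_int_diff field_simps)
    have 2: "1 / (norm \<zeta> * norm ?w) = 1 / (norm z0 * \<mu> * r) * R powi (- s - j)"
      using R0 by (simp add: norm_node \<zeta>(2) power_int_diff power_int_minus field_simps)
    show "\<delta> * \<epsilon> / 2 * norm (lat \<zeta>) \<le> norm (lat \<zeta> - y)"
      using lat_diff_lower_bound[OF \<zeta>(1) w, of \<delta> \<epsilon>] \<delta> \<epsilon> unfolding 1 2 y by simp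
  qed
  have big: "\<forall>\<^sub>F k in sequentially. norm (a * f k) \<ge> 1" if "a \<noteq> 0" for a
  proof -
    have "filterlim (\<lambda>k. a * f k) at_infinity sequentially"
      using that grow by (rule filterlim_cmult_at_infinity)
    then show ?thesis unfolding filterlim_at_infinity[OF order_refl] by auto
  qed
  have "\<forall>\<^sub>F k in sequentially. separated (\<delta> * \<epsilon> / 2) (support_points qh G) (lat_plus qh (f k))"
    using big[OF q]
  proof (rule eventually_mono)
    fix k assume "1 \<le> norm (qh * f k)"
    then show "separated (\<delta> * \<epsilon> / 2) (support_points qh G) (lat_plus qh (f k))"
      unfolding lat_plus_def
      by (rule sep[of _ "sg * int k"]) (use \<mu>(1) R0 in \<open>simp add: f_def norm_mult r_def norm_power_int\<close>)
  qed
  moreover have "\<forall>\<^sub>F k in sequentially. separated (\<delta> * \<epsilon> / 2) (support_points qh G) (lat_minus qh (f k))"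
    using big[of "inverse qh"]
  proof (rule eventually_mono)
    show "inverse qh \<noteq> 0" using q by simp
    fix k assume "1 \<le> norm (inverse qh * f k)"
    then have "1 \<le> norm (f k / qh)" by (simp add: divide_inverse mult.commute)
    moreover have "norm (f k / qh) = \<mu> * r * R powi (sg * int k - 1)"
    proof -
      have "norm (f k / qh) = \<mu> * R powi (sg * int k) / r"
        using \<mu>(1) R0 by (simp add: f_def norm_mult norm_divide r_def norm_power_int)
      also have "\<dots> = \<mu> * r * R powi (sg * int k - 1)"
        using R0 r0 by (simp add: power_int_diff, simp add: R_def power2_eq_square)
      finally show ?thesis .
    qed
    ultimately show "separated (\<delta> * \<epsilon> / 2) (support_points qh G) (lat_minus qh (f k))"
      unfolding lat_minus_def by (rule sep)
  qed
  ultimately show ?thesis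
    using that[of "filtermap f sequentially" "\<delta> * \<epsilon> / 2"] grow \<delta>(1) \<epsilon>(1)
    by (simp add: eventually_filtermap filterlim_def filtermap_bot_iff)
qed

section \<open>Cauchy transforms of the lattice integral\<close>

lemma lat_circle_node: "y \<in> {-1..1} \<Longrightarrow> lat (circle_node y) = complex_of_real y"
proof -
  assume "y \<in> {-1..1}"
  then have "y\<^sup>2 \<le> 1" by (simp add: abs_square_le_1 abs_le_iff)
  then have "(sqrt (1 - y\<^sup>2))\<^sup>2 = 1 - y\<^sup>2" by simp
  then have "inverse (circle_node y) = cnj (circle_node y)"
    by (simp add: circle_node_def complex_eq_iff)
  then show ?thesis by (simp add: lat_def circle_node_def complex_eq_iff)
qed

text \<open>Agreement over the support suffices, which permits cancelling \<open>x - lat z\<close>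
  when \<open>x\<close> lies off the support.\<close>

lemma lat_integral_cong:
  assumes "\<And>z. lat z \<in> support_points qh G \<Longrightarrow> f z = g z"
  shows "lat_integrable qh G f = lat_integrable qh G g"
    and "lat_integral qh G f = lat_integral qh G g"
proof -
  have "lat_integrable qh G f = lat_integrable qh G g \<and> lat_integral qh G f = lat_integral qh G g"
  proof (cases G)
    case (Lattice z0 S)
    have "f (lattice_node qh z0 s) = g (lattice_node qh z0 s)" if "s \<in> S" for s
      using assms[of "lattice_node qh z0 s"] Lattice that by simp
    then show ?thesis using Lattice by (auto intro!: summable_on_cong infsum_cong)
  next
    case (Interval c)
    have "f (circle_node y) = g (circle_node y)" if "y \<in> {-1..1}" for y
      using assms[of "circle_node y"] Interval that by (auto simp: lat_circle_node)
    then have "set_integrable lborel {-1..1} (\<lambda>y. f (circle_node y)) =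
        set_integrable lborel {-1..1} (\<lambda>y. g (circle_node y))"
      "(LBINT y:{-1..1}. f (circle_node y)) = (LBINT y:{-1..1}. g (circle_node y))"
      unfolding set_integrable_def
      by (auto intro!: Bochner_Integration.integrable_cong set_lebesgue_integral_cong simp: indicator_def)
    then show ?thesis using Interval by simp
  qed
  then show "lat_integrable qh G f = lat_integrable qh G g"
    and "lat_integral qh G f = lat_integral qh G g" by auto
qed

lemma
  assumes "lat_integrable qh G f" "lat_integrable qh G g"
  shows lat_integrable_add: "lat_integrable qh G (\<lambda>z. f z + g z)"
    and lat_integral_add: "lat_integral qh G (\<lambda>z. f z + g z) = lat_integral qh G f + lat_integral qh G g"
  using assms
  by (cases G; simp add: distrib_left summable_on_add infsum_add set_integral_add)+

lemma
  assumes "lat_integrable qh G f"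
  shows lat_integrable_cmult: "lat_integrable qh G (\<lambda>z. k * f z)"
    and lat_integral_cmult: "lat_integral qh G (\<lambda>z. k * f z) = k * lat_integral qh G f"
  using assms
  by (cases G; simp add: mult.left_commute[of _ k] summable_on_cmult_right infsum_cmult_right)+

text \<open>\<open>second_kind\<close> is the case of the density
  \<open>\<omega> z u * poly (p n u) (lat z)\<close>. General densities occur because the expansion
  keeps multiplying them by \<open>lat z\<close>.\<close>

definition cauchy_transform :: "complex \<Rightarrow> support \<Rightarrow> (complex \<Rightarrow> complex) \<Rightarrow> complex \<Rightarrow> complex" where
  "cauchy_transform qh G f x = lat_integral qh G (\<lambda>z. f z / (x - lat z))"

text \<open>Separation dominates the kernel by \<open>1 / (c * norm x)\<close>, so \<open>K\<close>
  can be the total mass of \<open>f\<close>, fixed before \<open>c\<close> and \<open>x\<close>.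
  Integrability of the quotient is included since the linearity rules ask for it.\<close>

lemma cauchy_transform_bound:
  assumes f: "lat_integrable qh G f"
  obtains K where "\<And>c x. c > 0 \<Longrightarrow> x \<noteq> 0 \<Longrightarrow> separated c (support_points qh G) x \<Longrightarrow>
    lat_integrable qh G (\<lambda>z. f z / (x - lat z)) \<and>
    norm (cauchy_transform qh G f x) \<le> K / (c * norm x)"
proof (cases G)
  case (Lattice z0 S)
  define h where "h s = lat_delta qh (lattice_node qh z0 s) * f (lattice_node qh z0 s)" for s
  \<comment> \<open>Unconditional summability of complex families is absolute, so the total mass is
    finite.\<close>
  have h: "(\<lambda>s. norm (h s)) summable_on S"
    using f Lattice by (simp add: h_def[abs_def] summable_on_iff_abs_summable_on_complex)
  show ?thesis
  proof (rule that[of "\<Sum>\<^sub>\<infinity>s\<in>S. norm (h s)"])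
    fix c :: real and x :: complex
    assume c: "c > 0" and x: "x \<noteq> 0" and sep: "separated c (support_points qh G) x"
    define g where "g s = h s / (x - lat (lattice_node qh z0 s))" for s
    have g: "norm (g s) \<le> inverse (c * norm x) * norm (h s)" if "s \<in> S" for s
    proof -
      have "c * norm x \<le> norm (x - lat (lattice_node qh z0 s))"
        using sep that Lattice unfolding separated_def by simp
      moreover from this have "0 < norm (x - lat (lattice_node qh z0 s))"
        by (rule less_le_trans[rotated]) (use c x in simp)
      ultimately have "norm (h s) / norm (x - lat (lattice_node qh z0 s)) \<le> norm (h s) / (c * norm x)"
        by (intro divide_left_mono mult_pos_pos norm_ge_zero) (use c x in auto)
      then show ?thesis by (simp add: g_def norm_divide field_simps)
    qed
    have sum: "(\<lambda>s. inverse (c * norm x) * norm (h s)) summable_on S"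
      using h by (rule summable_on_cmult_right)
    have abs: "(\<lambda>s. norm (g s)) summable_on S"
      using sum g by (rule summable_on_comparison_test) auto
    then have int: "g summable_on S" by (rule abs_summable_summable)
    have "norm (infsum g S) \<le> (\<Sum>\<^sub>\<infinity>s\<in>S. inverse (c * norm x) * norm (h s))"
      using abs by (intro order_trans[OF norm_infsum_bound] infsum_mono sum g)
    also have "\<dots> = (\<Sum>\<^sub>\<infinity>s\<in>S. norm (h s)) / (c * norm x)"
      by (simp add: infsum_cmult_right' divide_inverse)
    finally show "lat_integrable qh G (\<lambda>z. f z / (x - lat z)) \<and>
        norm (cauchy_transform qh G f x) \<le> (\<Sum>\<^sub>\<infinity>s\<in>S. norm (h s)) / (c * norm x)"
      using int Lattice by (simp add: cauchy_transform_def g_def[abs_def] h_def)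
  qed
next
  case (Interval k)
  define h where "h y = indicator {-1..1} y *\<^sub>R f (circle_node y)" for y :: real
  have h: "integrable lborel h"
    using f Interval by (simp add: set_integrable_def h_def[abs_def])
  show ?thesis
  proof (rule that[of "norm k * (\<integral>y. norm (h y) \<partial>lborel)"])
    fix c :: real and x :: complex
    assume c: "c > 0" and x: "x \<noteq> 0" and sep: "separated c (support_points qh G) x"
    define g where "g y = h y / (x - complex_of_real y)" for y
    have g: "norm (g y) \<le> inverse (c * norm x) * norm (h y)" for y
    proof (cases "y \<in> {-1..1}")
      case True
      then have "c * norm x \<le> norm (x - complex_of_real y)"
        using sep True Interval unfolding separated_def by simp
      moreover from this have "0 < norm (x - complex_of_real y)"
        by (rule less_le_trans[rotated]) (use c x in simp)
      ultimately have "norm (h y) / norm (x - complex_of_real y) \<le> norm (h y) / (c * norm x)"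
        by (intro divide_left_mono mult_pos_pos norm_ge_zero) (use c x in auto)
      then show ?thesis by (simp add: g_def norm_divide field_simps)
    qed (simp add: g_def h_def)
    have meas: "h \<in> borel_measurable lborel" using h by simp
    then have "g \<in> borel_measurable lborel" unfolding g_def by measurable
    moreover have dom: "integrable lborel (\<lambda>y. inverse (c * norm x) * norm (h y))"
      using h by simp
    ultimately have int: "integrable lborel g"
      using g c by (intro Bochner_Integration.integrable_bound[OF dom]) auto
    have "norm (\<integral>y. g y \<partial>lborel) \<le> (\<integral>y. inverse (c * norm x) * norm (h y) \<partial>lborel)"
      using int dom g by (intro order_trans[OF Bochner_Integration.integral_norm_bound] Bochner_Integration.integral_mono) auto
    also have "\<dots> = (\<integral>y. norm (h y) \<partial>lborel) / (c * norm x)"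
      by (simp add: divide_inverse)
    finally have bound: "norm k * norm (\<integral>y. g y \<partial>lborel)
        \<le> norm k * ((\<integral>y. norm (h y) \<partial>lborel) / (c * norm x))"
      by (intro mult_left_mono) auto
    have eq: "g = (\<lambda>y. indicator {-1..1} y *\<^sub>R (f (circle_node y) / (x - lat (circle_node y))))"
      by (auto simp: g_def h_def lat_circle_node indicator_def fun_eq_iff)
    show "lat_integrable qh G (\<lambda>z. f z / (x - lat z)) \<and>
        norm (cauchy_transform qh G f x) \<le> norm k * (\<integral>y. norm (h y) \<partial>lborel) / (c * norm x)"
      using int bound unfolding eq Interval
      by (simp add: cauchy_transform_def set_integrable_def set_lebesgue_integral_def norm_mult)
  qed
qed

text \<open>This is \<open>x / (x - y) = 1 + y / (x - y)\<close> under the integral: each factor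
  \<open>x\<close> splits off one moment.\<close>

lemma cauchy_transform_step:
  assumes f: "lat_integrable qh G f" "lat_integrable qh G (\<lambda>z. f z * lat z)"
    and x: "c > 0" "x \<noteq> 0" "separated c (support_points qh G) x"
  shows "x * cauchy_transform qh G f x = lat_integral qh G f + cauchy_transform qh G (\<lambda>z. f z * lat z) x"
proof -
  have int: "lat_integrable qh G (\<lambda>z. f z / (x - lat z))"
    "lat_integrable qh G (\<lambda>z. f z * lat z / (x - lat z))"
    using cauchy_transform_bound[OF f(1)] cauchy_transform_bound[OF f(2)] x by metis+
  have "x * cauchy_transform qh G f x = lat_integral qh G (\<lambda>z. x * (f z / (x - lat z)))"
    unfolding cauchy_transform_def using int(1) by (rule lat_integral_cmult[symmetric])
  also have "\<dots> = lat_integral qh G (\<lambda>z. f z + f z * lat z / (x - lat z))"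
  proof (rule lat_integral_cong)
    fix z assume "lat z \<in> support_points qh G"
    then have "x - lat z \<noteq> 0" using separated_notin[OF x(3) x(1,2)] by auto
    then show "x * (f z / (x - lat z)) = f z + f z * lat z / (x - lat z)"
      by (simp add: field_simps)
  qed
  also have "\<dots> = lat_integral qh G f + cauchy_transform qh G (\<lambda>z. f z * lat z) x"
    using f int by (simp add: lat_integral_add cauchy_transform_def)
  finally show ?thesis .
qed

lemma tendsto_cauchy_transform:
  assumes f: "lat_integrable qh G f" and "c > 0" and X: "filterlim X at_infinity F"
    and sep: "\<forall>\<^sub>F z in F. separated c (support_points qh G) (X z)"
  shows "((\<lambda>z. cauchy_transform qh G f (X z)) \<longlongrightarrow> 0) F"
proof -
  obtain K where K: "\<And>c x. c > 0 \<Longrightarrow> x \<noteq> 0 \<Longrightarrow> separated c (support_points qh G) x \<Longrightarrow>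
      norm (cauchy_transform qh G f x) \<le> K / (c * norm x)"
    using cauchy_transform_bound[OF f] by metis
  have inv: "((\<lambda>z. inverse (X z)) \<longlongrightarrow> 0) F"
    using filterlim_compose[OF tendsto_inverse_0 X] by simp
  have nz: "\<forall>\<^sub>F z in F. X z \<noteq> 0" using X by (simp add: filterlim_at_infinity_imp_eventually_ne)
  show ?thesis
  proof (rule tendsto_0_le[OF inv])
    show "\<forall>\<^sub>F z in F. norm (cauchy_transform qh G f (X z)) \<le> norm (inverse (X z)) * (K / c)"
      using sep nz
    proof eventually_elim
      case (elim z)
      then show ?case using K[OF \<open>c > 0\<close>, of "X z"] by (simp add: norm_inverse divide_inverse mult_ac)
    qed
  qed
qed

section \<open>First-order expansions at infinity\<close>

text \<open>\<open>f = c\<^sub>0 + c\<^sub>1 / s + o(1 / s)\<close> along \<open>F\<close>, for \<open>s\<close> tending to infinity\<close>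

definition expands ::
  "'a filter \<Rightarrow> ('a \<Rightarrow> complex) \<Rightarrow> ('a \<Rightarrow> complex) \<Rightarrow> complex \<Rightarrow> complex \<Rightarrow> bool" where
  "expands F s f c0 c1 \<longleftrightarrow> ((\<lambda>z. s z * (f z - c0)) \<longlongrightarrow> c1) F"

lemma expands_cong:
  assumes "\<forall>\<^sub>F z in F. f z = g z"
  shows "expands F s f c0 c1 \<longleftrightarrow> expands F s g c0 c1"
  unfolding expands_def by (rule tendsto_cong) (use assms in \<open>auto elim: eventually_mono\<close>)

lemma expands_const: "expands F s (\<lambda>_. c) c 0"
  by (simp add: expands_def)

lemma expands_add:
  "expands F s f c0 c1 \<Longrightarrow> expands F s g d0 d1 \<Longrightarrow> expands F s (\<lambda>z. f z + g z) (c0 + d0) (c1 + d1)"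
  unfolding expands_def by (drule (1) tendsto_add) (simp add: algebra_simps)

lemma expands_cmult: "expands F s f c0 c1 \<Longrightarrow> expands F s (\<lambda>z. k * f z) (k * c0) (k * c1)"
  unfolding expands_def by (drule tendsto_mult_left[of _ _ _ k]) (simp add: algebra_simps)

lemma expands_uminus: "expands F s f c0 c1 \<Longrightarrow> expands F s (\<lambda>z. - f z) (- c0) (- c1)"
  using expands_cmult[of F s f c0 c1 "-1"] by simp

lemma expands_diff:
  "expands F s f c0 c1 \<Longrightarrow> expands F s g d0 d1 \<Longrightarrow> expands F s (\<lambda>z. f z - g z) (c0 - d0) (c1 - d1)"
  using expands_add[OF _ expands_uminus] by fastforce

lemma tendsto_inverse_scale:
  fixes s :: "'a \<Rightarrow> complex"
  assumes "filterlim s at_infinity F"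
  shows "((\<lambda>z. inverse (s z)) \<longlongrightarrow> 0) F"
  using filterlim_compose[OF tendsto_inverse_0 assms] by simp

lemma expands_imp_tendsto:
  assumes s: "filterlim s at_infinity F" and f: "expands F s f c0 c1"
  shows "(f \<longlongrightarrow> c0) F"
proof -
  have "((\<lambda>z. c0 + inverse (s z) * (s z * (f z - c0))) \<longlongrightarrow> c0 + 0 * c1) F"
    using f unfolding expands_def by (intro tendsto_intros tendsto_inverse_scale[OF s])
  moreover have "\<forall>\<^sub>F z in F. c0 + inverse (s z) * (s z * (f z - c0)) = f z"
    using filterlim_at_infinity_imp_eventually_ne[OF s, of 0]
    by eventually_elim (simp add: field_simps)
  ultimately have "(f \<longlongrightarrow> c0 + 0 * c1) F" by (rule Lim_transform_eventually)
  then show ?thesis by simp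
qed

lemma expands_mult:
  assumes s: "filterlim s at_infinity F" and f: "expands F s f c0 c1" and g: "expands F s g d0 d1"
  shows "expands F s (\<lambda>z. f z * g z) (c0 * d0) (c0 * d1 + c1 * d0)"
proof -
  have "((\<lambda>z. c0 * (s z * (g z - d0)) + (s z * (f z - c0)) * g z) \<longlongrightarrow> c0 * d1 + c1 * d0) F"
    using f g expands_imp_tendsto[OF s g] unfolding expands_def by (intro tendsto_intros)
  then show ?thesis unfolding expands_def by (simp add: algebra_simps)
qed

text \<open>Ratios such as y_+/y_- have no 1/z term; their powers inherit this and contribute only
  constants like q^n.\<close>

lemma expands_power_stationary:
  assumes s: "filterlim s at_infinity F" and f: "expands F s f c 0"
  shows "expands F s (\<lambda>z. f z ^ n) (c ^ n) 0"
proof (induction n)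
  case 0
  then show ?case using expands_const[of F s 1] by simp
next
  case (Suc n)
  then show ?case using expands_mult[OF s f Suc] by simp
qed

lemma expands_inverse_scale:
  assumes "filterlim s at_infinity F"
  shows "expands F s (\<lambda>z. inverse (s z)) 0 1"
proof -
  have "\<forall>\<^sub>F z in F. 1 = s z * (inverse (s z) - 0)"
    using filterlim_at_infinity_imp_eventually_ne[OF assms, of 0]
    by eventually_elim simp
  then show ?thesis unfolding expands_def by (rule tendsto_eventually[OF eventually_mono]) auto
qed

text \<open>The variables y_+, y_-, \<open>z\<close> and \<open>lat z\<close> are asymptotically
  proportional. Passing from one to another affects only the first-order coefficient.\<close>

lemma expands_rescale:
  assumes s: "filterlim s at_infinity F" and k: "((\<lambda>z. s' z / s z) \<longlongrightarrow> k) F"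
    and f: "expands F s f c0 c1"
  shows "expands F s' f c0 (k * c1)"
proof -
  have "((\<lambda>z. s' z / s z * (s z * (f z - c0))) \<longlongrightarrow> k * c1) F"
    using k f unfolding expands_def by (intro tendsto_intros)
  moreover have "\<forall>\<^sub>F z in F. s' z / s z * (s z * (f z - c0)) = s' z * (f z - c0)"
    using filterlim_at_infinity_imp_eventually_ne[OF s, of 0]
    by eventually_elim (simp add: field_simps)
  ultimately show ?thesis unfolding expands_def by (simp cong: tendsto_cong)
qed

lemma expands_unique:
  assumes "F \<noteq> bot" and s: "filterlim s at_infinity F"
    and f: "expands F s f c0 c1" "expands F s f d0 d1"
  shows "c0 = d0" "c1 = d1"
proof -
  show "c0 = d0"
    using tendsto_unique[OF assms(1)] expands_imp_tendsto[OF s f(1)] expands_imp_tendsto[OF s f(2)]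
    by blast
  then show "c1 = d1"
    using tendsto_unique[OF assms(1)] f unfolding expands_def by blast
qed

lemma tendsto_poly_div_power:
  fixes s :: "'a \<Rightarrow> complex"
  assumes s: "filterlim s at_infinity F" and Q: "degree Q \<le> m"
  shows "((\<lambda>z. poly Q (s z) / s z ^ m) \<longlongrightarrow> coeff Q m) F"
proof -
  have "((\<lambda>z. \<Sum>i\<le>m. coeff Q i * inverse (s z) ^ (m - i)) \<longlongrightarrow> (\<Sum>i\<le>m. coeff Q i * 0 ^ (m - i))) F"
    by (intro tendsto_intros tendsto_inverse_scale[OF s])
  \<comment> \<open>Since \<open>0 ^ 0 = 1\<close>, exactly the term \<open>i = m\<close>
    survives.\<close>
  also have "(\<Sum>i\<le>m. coeff Q i * 0 ^ (m - i)) = (\<Sum>i\<le>m. if i = m then coeff Q i else 0)"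
    by (intro sum.cong) (auto simp: power_0_left)
  also have "\<dots> = coeff Q m" by simp
  finally have "((\<lambda>z. \<Sum>i\<le>m. coeff Q i * inverse (s z) ^ (m - i)) \<longlongrightarrow> coeff Q m) F" .
  moreover have "\<forall>\<^sub>F z in F. (\<Sum>i\<le>m. coeff Q i * inverse (s z) ^ (m - i)) = poly Q (s z) / s z ^ m"
    using filterlim_at_infinity_imp_eventually_ne[OF s, of 0]
  proof eventually_elim
    case (elim z)
    have "poly Q (s z) = (\<Sum>i\<le>m. coeff Q i * s z ^ i)"
      using Q by (simp add: poly_altdef) (intro sum.mono_neutral_left, auto simp: coeff_eq_0)
    then show ?case
      using elim by (auto simp: sum_divide_distrib power_diff power_inverse field_simps intro!: sum.cong)
  qed
  ultimately show ?thesis by (simp cong: tendsto_cong)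
qed

lemma expands_poly:
  assumes s: "filterlim s at_infinity F" and Q: "degree Q \<le> m" and m: "m \<ge> 1"
  shows "expands F s (\<lambda>z. poly Q (s z) / s z ^ m) (coeff Q m) (coeff Q (m - 1))"
proof -
  \<comment> \<open>Once the top term is removed, the second coefficient is a leading limit one
    degree lower.\<close>
  define Q' where "Q' = Q - monom (coeff Q m) m"
  have "coeff Q' i = 0" if "i > m - 1" for i
    using that Q m by (cases "i = m") (auto simp: Q'_def coeff_eq_0)
  then have "degree Q' \<le> m - 1" by (intro degree_le) auto
  then have "((\<lambda>z. poly Q' (s z) / s z ^ (m - 1)) \<longlongrightarrow> coeff Q' (m - 1)) F"
    by (rule tendsto_poly_div_power[OF s])
  moreover have "\<forall>\<^sub>F z in F. poly Q' (s z) / s z ^ (m - 1) = s z * (poly Q (s z) / s z ^ m - coeff Q m)"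
    using filterlim_at_infinity_imp_eventually_ne[OF s, of 0]
  proof eventually_elim
    case (elim z)
    obtain k where "m = Suc k" using m by (cases m) auto
    then show ?case using elim by (simp add: Q'_def poly_monom field_simps)
  qed
  ultimately have "expands F s (\<lambda>z. poly Q (s z) / s z ^ m) (coeff Q m) (coeff Q' (m - 1))"
    unfolding expands_def by (rule Lim_transform_eventually)
  moreover have "coeff Q' (m - 1) = coeff Q (m - 1)" using m by (auto simp: Q'_def)
  ultimately show ?thesis by metis
qed

text \<open>\<open>spectral_coeffs\<close> fixes \<open>Wn\<close> only through values near
  infinity, so the degree bound must be read off from the growth. Any excess degree would force the
  leading coefficient to be 0.\<close>

lemma degree_le_if_poly_div_power_tendsto:
  fixes s :: "'a \<Rightarrow> complex"
  assumes F: "F \<noteq> bot" and s: "filterlim s at_infinity F"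
    and Q: "((\<lambda>z. poly Q (s z) / s z ^ m) \<longlongrightarrow> c) F"
  shows "degree Q \<le> m"
proof (rule ccontr)
  assume "\<not> ?thesis"
  then have deg: "degree Q > m" by simp
  have "((\<lambda>z. poly Q (s z) / s z ^ m * inverse (s z) ^ (degree Q - m)) \<longlongrightarrow> c * 0 ^ (degree Q - m)) F"
    by (intro tendsto_intros Q tendsto_inverse_scale[OF s])
  moreover have "\<forall>\<^sub>F z in F. poly Q (s z) / s z ^ m * inverse (s z) ^ (degree Q - m) = poly Q (s z) / s z ^ degree Q"
    using filterlim_at_infinity_imp_eventually_ne[OF s, of 0]
  proof eventually_elim
    case (elim z)
    then show ?case using deg by (simp add: power_diff power_inverse field_simps)
  qed
  ultimately have "((\<lambda>z. poly Q (s z) / s z ^ degree Q) \<longlongrightarrow> c * 0 ^ (degree Q - m)) F"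
    by (rule Lim_transform_eventually)
  then have "((\<lambda>z. poly Q (s z) / s z ^ degree Q) \<longlongrightarrow> 0) F"
    using deg by (simp add: power_0_left)
  then have "lead_coeff Q = 0"
    using tendsto_unique[OF F] tendsto_poly_div_power[OF s order_refl] by blast
  then show False using deg by simp
qed

lemma expands_poly_coeff:
  assumes F: "F \<noteq> bot" and s: "filterlim s at_infinity F" and m: "m \<ge> 1"
    and Q: "expands F s (\<lambda>z. poly Q (s z) / s z ^ m) c0 c1"
  shows "coeff Q m = c0" "coeff Q (m - 1) = c1"
proof -
  have "degree Q \<le> m"
    using F s expands_imp_tendsto[OF s Q] by (rule degree_le_if_poly_div_power_tendsto)
  from expands_unique[OF F s expands_poly[OF s this m] Q]
  show "coeff Q m = c0" "coeff Q (m - 1) = c1" by auto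
qed

lemma expands_eqI: "expands F s f c0 c1 \<Longrightarrow> c0 = d0 \<Longrightarrow> c1 = d1 \<Longrightarrow> expands F s f d0 d1"
  by simp

lemma expands_inverse:
  assumes s: "filterlim s at_infinity F" and f: "expands F s f c0 c1" and c0: "c0 \<noteq> 0"
  shows "expands F s (\<lambda>z. inverse (f z)) (inverse c0) (- c1 / c0\<^sup>2)"
proof -
  have lim: "(f \<longlongrightarrow> c0) F" by (rule expands_imp_tendsto[OF s f])
  have "((\<lambda>z. - (s z * (f z - c0)) / (f z * c0)) \<longlongrightarrow> - c1 / (c0 * c0)) F"
    using f c0 unfolding expands_def by (intro tendsto_intros lim) auto
  moreover have "\<forall>\<^sub>F z in F. - (s z * (f z - c0)) / (f z * c0) = s z * (inverse (f z) - inverse c0)"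
    using tendsto_imp_eventually_ne[OF lim c0]
    by eventually_elim (use c0 in \<open>simp add: field_simps\<close>)
  ultimately show ?thesis
    unfolding expands_def power2_eq_square by (rule Lim_transform_eventually)
qed

text \<open>The reciprocal part of \<open>lat\<close> is smaller by z^-2 than the main part, hence
  the first-order coefficient 0.\<close>

lemma expands_lat_cmult:
  assumes F: "F \<le> at_infinity" and k: "k \<noteq> 0"
  shows "expands F (\<lambda>z. z) (\<lambda>z. lat (k * z) / z) (k / 2) 0"
proof -
  have id: "filterlim (\<lambda>z::complex. z) at_infinity F" using F by (simp add: filterlim_def)
  have "((\<lambda>z. inverse (k * z) / 2) \<longlongrightarrow> 0 / 2) F"
    by (intro tendsto_intros tendsto_inverse_scale filterlim_cmult_at_infinity k id) auto
  moreover have "\<forall>\<^sub>F z in F. inverse (k * z) / 2 = z * (lat (k * z) / z - k / 2)"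
    using filterlim_at_infinity_imp_eventually_ne[OF id, of 0]
    by eventually_elim (simp add: lat_def field_simps)
  ultimately show ?thesis
    unfolding expands_def using Lim_transform_eventually by fastforce
qed

section \<open>Orthonormal polynomials and functions of the second kind\<close>

definition moment ::
  "complex \<Rightarrow> support \<Rightarrow> (complex \<Rightarrow> complex \<Rightarrow> complex) \<Rightarrow> complex \<Rightarrow> complex poly \<Rightarrow> complex" where
  "moment qh G \<omega> u Q = lat_integral qh G (\<lambda>z. \<omega> z u * poly Q (lat z))"

lemma lat_integrable_poly:
  assumes "\<And>k. lat_integrable qh G (\<lambda>z. \<omega> z u * lat z ^ k)"
  shows "lat_integrable qh G (\<lambda>z. \<omega> z u * poly Q (lat z))"
proof -
  \<comment> \<open>The extra power of \<open>lat z\<close> strengthens the induction: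
    \<open>pCons\<close> multiplies the remaining polynomial by one more
    \<open>lat z\<close>.\<close>
  have "lat_integrable qh G (\<lambda>z. \<omega> z u * lat z ^ j * poly Q (lat z))" for j
  proof (induction Q arbitrary: j)
    case 0
    then show ?case using lat_integrable_cmult[OF assms[of 0], of 0] by simp
  next
    case (pCons a Q)
    then show ?case
      using lat_integrable_add[OF lat_integrable_cmult[OF assms[of j], of a] pCons(2)[of "Suc j"]]
      by (simp add: algebra_simps)
  qed
  from this[of 0] show ?thesis by simp
qed

text \<open>The variable \<open>u\<close> is frozen, so that the locale can be interpreted twice, at
  v_+ and at v_-.\<close>

locale orthonormal_polys =
  fixes qh :: complex and G :: support and \<omega> p n u
  assumes orth: "orthonormal_upto qh G \<omega> p n u"
begin

abbreviation "\<mu> \<equiv> moment qh G \<omega> u"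
abbreviation "\<gamma> k \<equiv> lead_coeff (p k u)"

lemma integrable_poly: "lat_integrable qh G (\<lambda>z. \<omega> z u * poly Q (lat z))"
  using orth by (intro lat_integrable_poly) (simp add: orthonormal_upto_def)

lemma moment_add: "\<mu> (Q + Q') = \<mu> Q + \<mu> Q'"
  by (simp add: moment_def distrib_left lat_integral_add integrable_poly)

lemma moment_smult: "\<mu> (smult c Q) = c * \<mu> Q"
  using lat_integral_cmult[OF integrable_poly[of Q], of c]
  by (simp add: moment_def mult.left_commute)

lemma degree_p: "k \<le> n \<Longrightarrow> degree (p k u) = k"
  and p_nonzero: "k \<le> n \<Longrightarrow> p k u \<noteq> 0"
  using orth by (auto simp: orthonormal_upto_def)

lemma lead_nonzero: "k \<le> n \<Longrightarrow> \<gamma> k \<noteq> 0"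
  using p_nonzero by simp

lemma moment_p_p: "i \<le> n \<Longrightarrow> j \<le> n \<Longrightarrow> \<mu> (p i u * p j u) = (if i = j then 1 else 0)"
  using orth by (simp add: orthonormal_upto_def moment_def mult.assoc)

text \<open>Top coefficients of \<open>Q\<close> are removed one at a time by multiples of
  \<open>p m u\<close> with \<open>m < k\<close>. Stating the bound by vanishing coefficients
  instead of \<open>degree Q < k\<close> also covers \<open>k = 0\<close>, where
  \<open>Q = 0\<close>.\<close>

lemma moment_p_lower:
  assumes "k \<le> n" "\<And>i. i \<ge> k \<Longrightarrow> coeff Q i = 0"
  shows "\<mu> (p k u * Q) = 0"
proof -
  have "\<forall>Q. (\<forall>i\<ge>m. coeff Q i = 0) \<longrightarrow> \<mu> (p k u * Q) = 0" if "m \<le> k" for m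
    using that
  proof (induction m)
    case 0
    have "Q = 0" if "\<forall>i\<ge>0. coeff Q i = 0" for Q :: "complex poly"
      using that by (simp add: poly_eq_iff)
    moreover have "\<mu> (p k u * 0) = 0" using moment_smult[of 0 0] by simp
    ultimately show ?case by metis
  next
    case (Suc m)
    show ?case
    proof (intro allI impI)
      fix Q :: "complex poly" assume Q: "\<forall>i\<ge>Suc m. coeff Q i = 0"
      define c where "c = coeff Q m / \<gamma> m"
      have m: "m \<le> n" "m < k" using Suc.prems assms(1) by auto
      have "coeff (Q - smult c (p m u)) i = 0" if "i \<ge> m" for i
        using that Q m lead_nonzero[OF m(1)] degree_p[OF m(1)]
        by (cases "i = m") (auto simp: c_def coeff_eq_0)
      then have "\<mu> (p k u * (Q - smult c (p m u))) = 0" using Suc m by auto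
      moreover have "\<mu> (smult c (p k u * p m u)) = 0"
        using moment_p_p[OF assms(1) m(1)] m by (simp add: moment_smult)
      moreover have "p k u * Q = p k u * (Q - smult c (p m u)) + smult c (p k u * p m u)"
        by (simp add: algebra_simps)
      ultimately show "\<mu> (p k u * Q) = 0" by (simp add: moment_add)
    qed
  qed
  then show ?thesis using assms by blast
qed

text \<open>Modulo lower degrees, \<open>monom 1 k\<close> is \<open>p k u\<close> divided by its
  leading coefficient.\<close>

lemma moment_p_monom:
  assumes "k \<le> n"
  shows "\<mu> (p k u * monom 1 k) = 1 / \<gamma> k"
proof -
  let ?Q = "monom 1 k - smult (1 / \<gamma> k) (p k u)"
  have "coeff ?Q i = 0" if "i \<ge> k" for i
    using that lead_nonzero[OF assms] degree_p[OF assms]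
    by (cases "i = k") (auto simp: coeff_eq_0)
  then have "\<mu> (p k u * ?Q) = 0" by (rule moment_p_lower[OF assms])
  moreover have "p k u * monom 1 k = p k u * ?Q + smult (1 / \<gamma> k) (p k u * p k u)"
    by (simp add: algebra_simps)
  ultimately show ?thesis
    using moment_p_p[OF assms assms] by (simp add: moment_add moment_smult)
qed

text \<open>With \<pi> the subleading coefficient of the monic p_n, x^n is p_n/\<gamma>_n minus
  \<pi> x^(n-1), up to degrees below n-1. Against p_(n-1) only the middle term survives. This is how
  the subleading coefficient of p_n enters q_(n-1).\<close>

lemma moment_p_monom_Suc:
  assumes "n \<ge> 1"
  shows "\<mu> (p (n - 1) u * monom 1 n) = - (coeff (p n u) (n - 1) / (\<gamma> n * \<gamma> (n - 1)))"
proof -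
  let ?c = "coeff (p n u) (n - 1) / \<gamma> n"
  let ?Q = "monom 1 n - smult (1 / \<gamma> n) (p n u) + smult ?c (monom 1 (n - 1))"
  have "coeff ?Q i = 0" if "i \<ge> n - 1" for i
  proof -
    consider "i = n - 1" | "i = n" | "i > n" using \<open>i \<ge> n - 1\<close> by linarith
    then show ?thesis
      using assms lead_nonzero[of n] degree_p[of n] by cases (auto simp: coeff_eq_0)
  qed
  then have "\<mu> (p (n - 1) u * ?Q) = 0" by (intro moment_p_lower) auto
  moreover have "p (n - 1) u * monom 1 n =
      p (n - 1) u * ?Q + smult (1 / \<gamma> n) (p (n - 1) u * p n u) + smult (- ?c) (p (n - 1) u * monom 1 (n - 1))"
    by (simp add: algebra_simps)
  moreover have "\<mu> (p (n - 1) u * p n u) = 0" using moment_p_p[of "n - 1" n] assms by simp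
  ultimately show ?thesis
    using moment_p_monom[of "n - 1"] by (simp only: moment_add moment_smult) simp
qed

section \<open>Asymptotics of the functions of the second kind\<close>

text \<open>Iterating \<open>cauchy_transform_step\<close> meets \<open>k\<close> moments that
  vanish by orthogonality, then the moment 1/\<gamma>_k; the remainder is again a Cauchy
  transform.\<close>

lemma second_kind_expand:
  assumes k: "k \<le> n" and x: "c > 0" "x \<noteq> 0" "separated c (support_points qh G) x"
  shows "x ^ (k + 1) * second_kind qh G \<omega> p k x u =
    1 / \<gamma> k + cauchy_transform qh G (\<lambda>z. \<omega> z u * poly (p k u * monom 1 (k + 1)) (lat z)) x"
proof -
  define N where "N j = cauchy_transform qh G (\<lambda>z. \<omega> z u * poly (p k u * monom 1 j) (lat z)) x" for j
  have shift: "(\<lambda>z. \<omega> z u * poly (p k u * monom 1 j) (lat z) * lat z) =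
      (\<lambda>z. \<omega> z u * poly (p k u * monom 1 (Suc j)) (lat z))" for j
    by (simp add: poly_monom mult_ac)
  have step: "x * N j = \<mu> (p k u * monom 1 j) + N (Suc j)" for j
    using cauchy_transform_step[OF integrable_poly[of "p k u * monom 1 j"] _ x] integrable_poly
    unfolding shift N_def moment_def by blast
  have "x ^ j * N 0 = N j" if "j \<le> k" for j
    using that
  proof (induction j)
    case (Suc j)
    have "\<mu> (p k u * monom 1 j) = 0"
      using Suc.prems k by (intro moment_p_lower) auto
    then show ?case using Suc step[of j] by (simp add: mult.assoc)
  qed simp
  then have "x ^ (k + 1) * N 0 = x * N k" by (simp add: mult.assoc)
  also have "\<dots> = 1 / \<gamma> k + N (k + 1)"
    using step[of k] moment_p_monom[OF k] by simp
  finally have "x ^ (k + 1) * N 0 = 1 / \<gamma> k + N (k + 1)" .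
  moreover have "second_kind qh G \<omega> p k x u = N 0"
    by (simp add: second_kind_def N_def cauchy_transform_def poly_monom)
  ultimately show ?thesis by (simp only: N_def)
qed

text \<open>The second coefficient stays an unevaluated moment. For \<open>k = n\<close> it would
  involve p_(n+1), but only the leading term of q_n contributes later.\<close>

lemma expands_second_kind:
  assumes k: "k \<le> n" and c: "c > 0" and X: "filterlim X at_infinity F"
    and sep: "\<forall>\<^sub>F z in F. separated c (support_points qh G) (X z)"
  shows "expands F X (\<lambda>z. X z ^ (k + 1) * second_kind qh G \<omega> p k (X z) u)
    (1 / \<gamma> k) (\<mu> (p k u * monom 1 (k + 1)))"
proof -
  let ?f = "\<lambda>j z. \<omega> z u * poly (p k u * monom 1 j) (lat z)"
  have "((\<lambda>z. \<mu> (p k u * monom 1 (k + 1)) + cauchy_transform qh G (?f (k + 2)) (X z)) \<longlongrightarrow>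
      \<mu> (p k u * monom 1 (k + 1)) + 0) F"
    by (intro tendsto_intros tendsto_cauchy_transform[OF _ c X sep] integrable_poly)
  moreover have "\<forall>\<^sub>F z in F. \<mu> (p k u * monom 1 (k + 1)) + cauchy_transform qh G (?f (k + 2)) (X z) =
      X z * (X z ^ (k + 1) * second_kind qh G \<omega> p k (X z) u - 1 / \<gamma> k)"
    using sep filterlim_at_infinity_imp_eventually_ne[OF X, of 0]
  proof eventually_elim
    case (elim z)
    have shift: "(\<lambda>z. ?f (k + 1) z * lat z) = ?f (k + 2)"
      by (simp add: poly_monom mult_ac)
    have int: "lat_integrable qh G (\<lambda>z. ?f (k + 1) z * lat z)"
      unfolding shift by (rule integrable_poly)
    show ?case
      using cauchy_transform_step[OF integrable_poly int c elim(2,1)]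
        second_kind_expand[OF k c elim(2,1)]
      unfolding shift moment_def by simp
  qed
  ultimately have "((\<lambda>z. X z * (X z ^ (k + 1) * second_kind qh G \<omega> p k (X z) u - 1 / \<gamma> k)) \<longlongrightarrow>
      \<mu> (p k u * monom 1 (k + 1)) + 0) F"
    by (rule Lim_transform_eventually)
  then show ?thesis by (simp add: expands_def)
qed

end

section \<open>The coefficient \<open>w\<^sub>2\<close>\<close>

context orthonormal_polys begin

lemma expands_p:
  assumes X: "filterlim X at_infinity F" and k: "1 \<le> k" "k \<le> n"
  shows "expands F X (\<lambda>z. poly (p k u) (X z) / X z ^ k) (\<gamma> k) (coeff (p k u) (k - 1))"
  using expands_poly[OF X _ k(1), of "p k u"] degree_p[OF k(2)] by simp

text \<open>At \<open>k = 0\<close> the index \<open>k - 1\<close> truncates to 0 and would return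
  the leading coefficient. The existential form handles \<open>p (n - 1)\<close> for
  \<open>n = 1\<close> as well.\<close>

lemma expands_p_ex:
  assumes X: "filterlim X at_infinity F" and k: "k \<le> n"
  shows "\<exists>c. expands F X (\<lambda>z. poly (p k u) (X z) / X z ^ k) (\<gamma> k) c"
proof (cases k)
  case 0
  then obtain b where "p k u = [:b:]" using degree_p[OF k] by (auto elim: degree_eq_zeroE)
  then show ?thesis using expands_const[of F X b] 0 by auto
qed (use expands_p[OF X _ k] in auto)

text \<open>The relative first-order term of q_(n-1) is the negative of that of p_n, so their
  product at different points sees only the difference of the two shifts.\<close>

lemma expands_second_kind_pred:
  assumes n: "n \<ge> 1" and "c > 0" and "filterlim X at_infinity F"
    and "\<forall>\<^sub>F z in F. separated c (support_points qh G) (X z)"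
  shows "expands F X (\<lambda>z. X z ^ (n - 1 + 1) * second_kind qh G \<omega> p (n - 1) (X z) u)
    (1 / \<gamma> (n - 1)) (- (coeff (p n u) (n - 1) / \<gamma> n / \<gamma> (n - 1)))"
proof -
  have "\<mu> (p (n - 1) u * monom 1 (n - 1 + 1)) = - (coeff (p n u) (n - 1) / \<gamma> n / \<gamma> (n - 1))"
    using moment_p_monom_Suc[OF n] n by simp
  with expands_second_kind[OF diff_le_self assms(2-4), of 1] show ?thesis by (simp only:)
qed

text \<open>Adding the two equations for the spectral coefficients isolates
  \<open>2 * Wn - W\<close>. Since W \<plusminus> \<Delta>y V grows like z^3, the first two terms of
  the products p_n q_(n-1) give the coefficients of x^3 and x^2. \<open>e1\<close>,
  \<open>e3\<close>, \<open>e4\<close> are the elementary symmetric functions of the four fixed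
  parameters over \<open>qh\<close>, so the two brackets in the last line are \<sigma>_5 and
  \<sigma>_1.\<close>

lemma coeff_2_spectral:
  assumes n: "n \<ge> 1" and q: "qh \<noteq> 0" and \<tau>: "\<tau> \<noteq> 0"
    and F: "F \<noteq> bot" "F \<le> at_infinity" and c: "c > 0"
    and sepp: "\<forall>\<^sub>F z in F. separated c (support_points qh G) (lat_plus qh z)"
    and sepm: "\<forall>\<^sub>F z in F. separated c (support_points qh G) (lat_minus qh z)"
    and data: "spectral_data qh a \<alpha> \<tau> W V"
    and coeffs: "spectral_coeffs qh G \<omega> p n u W V Wn \<Omega>n"
    and e_top: "expands F (\<lambda>z. z) (\<lambda>z. \<Prod>j=1..4. inverse z - a j / qh) e4 (- e3)"
    and e_bot: "expands F (\<lambda>z. z) (\<lambda>z. \<Prod>j=1..4. 1 - a j / qh * inverse z) 1 (- e1)"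
  defines "\<beta> \<equiv> \<alpha> / qh" and "N \<equiv> (qh\<^sup>2) ^ n"
  shows "coeff (2 * Wn - W) 2 =
    - 4 * (qh - inverse qh) * (N * (e4 * \<beta>\<^sup>2) - inverse N) * (coeff (p n u) (n - 1) / \<gamma> n)
    - 2 * (N * (\<beta>\<^sup>2 * e3 + e4 * \<beta> * (\<tau> + inverse \<tau>)) + inverse N * (e1 + \<beta> * (\<tau> + inverse \<tau>)))"
proof -
  let ?s = "\<lambda>z::complex. z"
  let ?an = "rec_coeff p n u"
  let ?\<pi> = "coeff (p n u) (n - 1) / \<gamma> n"
  define Yp Ym where "Yp = lat_plus qh" and "Ym = lat_minus qh"
  \<comment> \<open>These are the two data products divided by z^3, written in 1/z.\<close>
  define W3p W3m where
    "W3p = (\<lambda>z::complex. (\<Prod>j=1..4. inverse z - a j / qh) * ((inverse z - \<beta> * \<tau>) * (inverse z - \<beta> / \<tau>)))"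
    and "W3m = (\<lambda>z::complex. (\<Prod>j=1..4. 1 - a j / qh * inverse z) *
      ((1 - \<beta> * \<tau> * inverse z) * (1 - \<beta> / \<tau> * inverse z)))"
  have id: "filterlim ?s at_infinity F" using F(2) by (simp add: filterlim_def)
  note mult = expands_mult[OF id] and inv = expands_inverse_scale[OF id]
  have Yp_eq: "Yp z = lat (qh * z)" and Ym_eq: "Ym z = lat (inverse qh * z)" for z
    by (simp_all add: Yp_def Ym_def lat_plus_def lat_minus_def divide_inverse mult.commute)
  have Yp: "filterlim Yp at_infinity F" and Ym: "filterlim Ym at_infinity F"
    using q unfolding Yp_eq[abs_def] Ym_eq[abs_def]
    by (auto intro!: filterlim_lat_at_infinity filterlim_cmult_at_infinity id)
  have rp: "expands F ?s (\<lambda>z. Yp z / z) (qh / 2) 0" and rm: "expands F ?s (\<lambda>z. Ym z / z) (inverse qh / 2) 0"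
    unfolding Yp_eq Ym_eq using q by (auto intro!: expands_lat_cmult F)
  have irp: "expands F ?s (\<lambda>z. z / Yp z) (2 / qh) 0" and irm: "expands F ?s (\<lambda>z. z / Ym z) (2 * qh) 0"
    using expands_inverse[OF id rp] expands_inverse[OF id rm] q by (simp_all add: field_simps)
  \<comment> \<open>These limits turn expansions in 1/y_+ and 1/y_- into expansions in 1/z. The
    factors \<open>2 / qh\<close> and \<open>2 * qh\<close> on the subleading terms produce
    \<open>qh - inverse qh\<close>.\<close>
  note kp = expands_imp_tendsto[OF id irp] and km = expands_imp_tendsto[OF id irm]
  have nz: "\<forall>\<^sub>F z in F. z \<noteq> 0" "\<forall>\<^sub>F z in F. Yp z \<noteq> 0" "\<forall>\<^sub>F z in F. Ym z \<noteq> 0"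
    using id Yp Ym by (simp_all add: filterlim_at_infinity_imp_eventually_ne)
  \<comment> \<open>p_n grows like y^n and q_(n-1) decays like y^(-n), at opposite shifts; the
    powers of this ratio and of its reciprocal are the source of \<open>N\<close> and
    \<open>inverse N\<close>.\<close>
  have "expands F ?s (\<lambda>z. Yp z / z * (z / Ym z)) (qh\<^sup>2) 0"
    using mult[OF rp irm] by (simp add: power2_eq_square)
  then have ratio: "expands F ?s (\<lambda>z. (Yp z / z * (z / Ym z)) ^ k) ((qh\<^sup>2) ^ k) 0" for k
    by (rule expands_power_stationary[OF id])
  have "expands F ?s (\<lambda>z. Ym z / z * (z / Yp z)) (inverse (qh\<^sup>2)) 0"
    using mult[OF rm irp] q by (simp add: power2_eq_square field_simps)
  then have iratio: "expands F ?s (\<lambda>z. (Ym z / z * (z / Yp z)) ^ k) (inverse (qh\<^sup>2) ^ k) 0" for k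
    by (rule expands_power_stationary[OF id])
  have pp: "expands F ?s (\<lambda>z. poly (p n u) (Yp z) / Yp z ^ n) (\<gamma> n) (2 / qh * (\<gamma> n * ?\<pi>))"
    and pm: "expands F ?s (\<lambda>z. poly (p n u) (Ym z) / Ym z ^ n) (\<gamma> n) (2 * qh * (\<gamma> n * ?\<pi>))"
    using expands_rescale[OF Yp kp expands_p[OF Yp n order_refl]]
      expands_rescale[OF Ym km expands_p[OF Ym n order_refl]] lead_nonzero[of n] by auto
  have sepp': "\<forall>\<^sub>F z in F. separated c (support_points qh G) (Yp z)"
    and sepm': "\<forall>\<^sub>F z in F. separated c (support_points qh G) (Ym z)"
    using sepp sepm by (simp_all add: Yp_def Ym_def)
  obtain c1 where "expands F Yp (\<lambda>z. poly (p (n - 1) u) (Yp z) / Yp z ^ (n - 1)) (\<gamma> (n - 1)) c1"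
    using expands_p_ex[OF Yp diff_le_self] by blast
  note p'p = expands_rescale[OF Yp kp this]
  obtain c2 where "expands F Ym (\<lambda>z. poly (p (n - 1) u) (Ym z) / Ym z ^ (n - 1)) (\<gamma> (n - 1)) c2"
    using expands_p_ex[OF Ym diff_le_self] by blast
  note p'm = expands_rescale[OF Ym km this]
  let ?q = "\<lambda>k y. y ^ (k + 1) * second_kind qh G \<omega> p k y u"
  note qp = expands_rescale[OF Yp kp expands_second_kind[OF order_refl c Yp sepp']]
  note qm = expands_rescale[OF Ym km expands_second_kind[OF order_refl c Ym sepm']]
  have q'p: "expands F ?s (\<lambda>z. ?q (n - 1) (Yp z)) (1 / \<gamma> (n - 1)) (2 / qh * - (?\<pi> / \<gamma> (n - 1)))"
    using expands_rescale[OF Yp kp expands_second_kind_pred[OF n c Yp sepp']] .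
  have q'm: "expands F ?s (\<lambda>z. ?q (n - 1) (Ym z)) (1 / \<gamma> (n - 1)) (2 * qh * - (?\<pi> / \<gamma> (n - 1)))"
    using expands_rescale[OF Ym km expands_second_kind_pred[OF n c Ym sepm']] .
  have W3p: "expands F ?s W3p (e4 * \<beta>\<^sup>2) (- (\<beta>\<^sup>2 * e3 + e4 * \<beta> * (\<tau> + inverse \<tau>)))"
    unfolding W3p_def
    by (rule expands_eqI[OF mult[OF e_top mult[OF expands_diff[OF inv expands_const[of F ?s "\<beta> * \<tau>"]]
        expands_diff[OF inv expands_const[of F ?s "\<beta> / \<tau>"]]]]])
      (use \<tau> in \<open>simp_all add: field_simps power2_eq_square\<close>)
  have W3m: "expands F ?s W3m 1 (- (e1 + \<beta> * (\<tau> + inverse \<tau>)))"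
    unfolding W3m_def
    by (rule expands_eqI[OF mult[OF e_bot
        mult[OF expands_diff[OF expands_const[of F ?s 1] expands_cmult[OF inv, of "\<beta> * \<tau>"]]
          expands_diff[OF expands_const[of F ?s 1] expands_cmult[OF inv, of "\<beta> / \<tau>"]]]]])
      (use \<tau> in \<open>simp_all add: field_simps\<close>)
  have six: "{1..6::nat} = insert 5 (insert 6 {1..4})" by auto
  have data': "poly W (lat z) + lat_delta qh z * poly V (lat z) = z ^ 3 * W3p z"
    "poly W (lat z) - lat_delta qh z * poly V (lat z) = z ^ 3 * W3m z" if z: "z \<noteq> 0" for z
  proof -
    have "(\<Prod>j=1..4. 1 - a j / qh * z) = (\<Prod>j=1..4. z * (inverse z - a j / qh))"
      using z by (intro prod.cong) (auto simp: field_simps)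
    also have "\<dots> = z ^ 4 * (\<Prod>j=1..4. inverse z - a j / qh)"
      by (simp add: prod.distrib)
    finally have quad: "(\<Prod>j=1..4. 1 - a j / qh * z) = z ^ 4 * (\<Prod>j=1..4. inverse z - a j / qh)" .
    have alg: "inverse z ^ 3 * ((1 - \<beta> * \<tau> * z) * ((1 - \<beta> / \<tau> * z) * (z ^ 4 * P))) =
        z ^ 3 * (P * ((inverse z - \<beta> * \<tau>) * (inverse z - \<beta> / \<tau>)))" for P
      using z \<tau> by (simp add: field_simps power_eq_if)
    have prod6: "(\<Prod>j=1..6. 1 - params a \<alpha> \<tau> j / qh * y) =
        (1 - \<beta> * \<tau> * y) * ((1 - \<beta> / \<tau> * y) * (\<Prod>j=1..4. 1 - a j / qh * y))" for y
      unfolding six by (simp add: params_def \<beta>_def mult_ac)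
    show "poly W (lat z) + lat_delta qh z * poly V (lat z) = z ^ 3 * W3p z"
      unfolding W3p_def alg[symmetric] quad[symmetric] prod6[symmetric]
      using data z by (simp add: spectral_data_def)
    have "poly W (lat z) - lat_delta qh z * poly V (lat z) =
        z ^ 3 * ((1 - \<beta> * \<tau> * inverse z) * ((1 - \<beta> / \<tau> * inverse z) * (\<Prod>j=1..4. 1 - a j / qh * inverse z)))"
      unfolding prod6[symmetric] using data z by (simp add: spectral_data_def)
    then show "poly W (lat z) - lat_delta qh z * poly V (lat z) = z ^ 3 * W3m z"
      by (simp only: W3m_def mult_ac)
  qed
  define main1 where "main1 = (\<lambda>z. W3p z * ((Yp z / z * (z / Ym z)) ^ n *
    (poly (p n u) (Yp z) / Yp z ^ n * ?q (n - 1) (Ym z))))"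
  define main2 where "main2 = (\<lambda>z. W3m z * ((Ym z / z * (z / Yp z)) ^ n *
    (poly (p n u) (Ym z) / Ym z ^ n * ?q (n - 1) (Yp z))))"
  \<comment> \<open>In p_(n-1) q_n two powers of y remain uncompensated, so these terms are O(z^-2)
    and reach neither coefficient.\<close>
  define rest1 where "rest1 = (\<lambda>z. W3m z * ((Ym z / z * (z / Yp z)) ^ (n - 1) *
    (poly (p (n - 1) u) (Ym z) / Ym z ^ (n - 1) * ?q n (Yp z)) * ((inverse z * (z / Yp z)) * (inverse z * (z / Yp z)))))"
  define rest2 where "rest2 = (\<lambda>z. W3p z * ((Yp z / z * (z / Ym z)) ^ (n - 1) *
    (poly (p (n - 1) u) (Yp z) / Yp z ^ (n - 1) * ?q n (Ym z)) * ((inverse z * (z / Ym z)) * (inverse z * (z / Ym z)))))"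
  have an: "?an \<noteq> 0" "?an = \<gamma> (n - 1) / \<gamma> n" and g: "\<gamma> n \<noteq> 0" "\<gamma> (n - 1) \<noteq> 0"
    using lead_nonzero[of n] lead_nonzero[of "n - 1"] by (auto simp: rec_coeff_def)
  have N0: "N \<noteq> 0" using q by (simp add: N_def)
  have main1: "expands F ?s main1 (e4 * \<beta>\<^sup>2 * N / ?an)
      ((N / ?an) * (- (\<beta>\<^sup>2 * e3 + e4 * \<beta> * (\<tau> + inverse \<tau>)) - 2 * (qh - inverse qh) * ?\<pi> * e4 * \<beta>\<^sup>2))"
    unfolding main1_def an(2) N_def
    by (rule expands_eqI[OF mult[OF W3p mult[OF ratio[of n] mult[OF pp q'm]]]])
      (use g q in \<open>simp_all add: field_simps\<close>)
  have main2: "expands F ?s main2 (inverse N / ?an)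
      ((inverse N / ?an) * (- (e1 + \<beta> * (\<tau> + inverse \<tau>)) + 2 * (qh - inverse qh) * ?\<pi>))"
    unfolding main2_def an(2) N_def
    by (rule expands_eqI[OF mult[OF W3m mult[OF iratio[of n] mult[OF pm q'p]]]])
      (use g q in \<open>simp_all add: field_simps\<close>)
  have rest1: "expands F ?s rest1 0 0"
    using mult[OF W3m mult[OF mult[OF iratio[of "n - 1"] mult[OF p'm qp]] mult[OF mult[OF inv irp] mult[OF inv irp]]]]
    unfolding rest1_def by simp
  have rest2: "expands F ?s rest2 0 0"
    using mult[OF W3p mult[OF mult[OF ratio[of "n - 1"] mult[OF p'p qm]] mult[OF mult[OF inv irm] mult[OF inv irm]]]]
    unfolding rest2_def by simp
  define Q where "Q = 2 * Wn - W"
  define tot where "tot = (\<lambda>z. ?an / 2 * ((main1 z - rest1 z) + (main2 z - rest2 z)))"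
  define C1 where "C1 = ?an / 2 *
      ((N / ?an) * (- (\<beta>\<^sup>2 * e3 + e4 * \<beta> * (\<tau> + inverse \<tau>)) - 2 * (qh - inverse qh) * ?\<pi> * e4 * \<beta>\<^sup>2)
      + (inverse N / ?an) * (- (e1 + \<beta> * (\<tau> + inverse \<tau>)) + 2 * (qh - inverse qh) * ?\<pi>))"
  \<comment> \<open>\<open>C0\<close> belongs to x^3; only \<open>C1\<close> feeds the coefficient
    of x^2.\<close>
  obtain C0 where tot: "expands F ?s tot C0 C1"
    using expands_cmult[OF expands_add[OF expands_diff[OF main1 rest1] expands_diff[OF main2 rest2]], of "?an / 2"]
    unfolding tot_def C1_def by simp
  have ev: "\<forall>\<^sub>F z in F. poly Q (lat z) / z ^ 3 = tot z"
    using filter_leD[OF F(2) coeffs[unfolded spectral_coeffs_def]] nz sepp sepm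
  proof eventually_elim
    case (elim z)
    have notin: "lat_plus qh z \<notin> support_points qh G" "lat_minus qh z \<notin> support_points qh G"
      using separated_notin[OF elim(5) c] separated_notin[OF elim(6) c] elim(3,4)
      by (auto simp: Yp_def Ym_def)
    let ?P = "\<lambda>k y. poly (p k u) y" and ?Q = "\<lambda>k y. second_kind qh G \<omega> p k y u"
    have Q: "poly Q x = 2 * poly Wn x - poly W x" for x
      by (simp add: Q_def)
    note conj = elim(1)[unfolded Let_def data'[OF elim(2)], rule_format, OF notin]
    \<comment> \<open>Adding the two equations cancels the part with \<Delta>y (\<Omega>_n +
      V).\<close>
    have sum_diff: "2 * x = A + B" if "x + y = A" "x - y = B" for x y A B :: complex
      using that by auto
    have "2 * poly Q (lat z) =
        ?an * (z ^ 3 * W3p z * ?P n (Yp z) * ?Q (n - 1) (Ym z) - z ^ 3 * W3m z * ?P (n - 1) (Ym z) * ?Q n (Yp z)) +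
        ?an * (- (z ^ 3 * W3p z) * ?P (n - 1) (Yp z) * ?Q n (Ym z) + z ^ 3 * W3m z * ?P n (Ym z) * ?Q (n - 1) (Yp z))"
      unfolding Yp_def Ym_def Q by (rule sum_diff[OF conjunct1[OF conj] conjunct2[OF conj]])
    moreover have "W3p z * ?P n (Yp z) * ?Q (n - 1) (Ym z) = main1 z"
      using elim(2,3,4) n by (simp add: main1_def field_simps)
    moreover have "W3m z * ?P n (Ym z) * ?Q (n - 1) (Yp z) = main2 z"
      using elim(2,3,4) n by (simp add: main2_def field_simps)
    moreover have "W3m z * ?P (n - 1) (Ym z) * ?Q n (Yp z) = rest1 z"
    proof -
      obtain m where "n = Suc m" using n by (cases n) auto
      then show ?thesis using elim(2,3,4) by (simp add: rest1_def field_simps)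
    qed
    moreover have "W3p z * ?P (n - 1) (Yp z) * ?Q n (Ym z) = rest2 z"
    proof -
      obtain m where "n = Suc m" using n by (cases n) auto
      then show ?thesis using elim(2,3,4) by (simp add: rest2_def field_simps)
    qed
    ultimately have "2 * poly Q (lat z) = ?an * (z ^ 3 * main1 z - z ^ 3 * rest1 z) +
        ?an * (- (z ^ 3 * rest2 z) + z ^ 3 * main2 z)"
      by (simp only: mult.assoc mult_minus_left)
    moreover have tot2: "2 * tot z = ?an * ((main1 z - rest1 z) + (main2 z - rest2 z))"
      by (simp add: tot_def)
    ultimately have "2 * poly Q (lat z) = z ^ 3 * (2 * tot z)"
      unfolding tot2 by (simp add: algebra_simps)
    then show ?case using elim(2) by (simp add: field_simps)
  qed
  have lat: "filterlim lat at_infinity F" using filterlim_lat_at_infinity[OF id] .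
  have rl: "expands F ?s (\<lambda>z. lat z / z) (1 / 2) 0"
    using expands_lat_cmult[OF F(2), of 1] by simp
  \<comment> \<open>Replacing z^3 by \<open>lat z ^ 3\<close> costs a factor 8, changing the scale
    to \<open>lat z\<close> a factor 1/2; together they give \<open>4 * C1\<close>.\<close>
  have irl: "expands F ?s (\<lambda>z. inverse (lat z / z) ^ 3) (2 ^ 3) 0"
    using expands_inverse[OF id rl] by (intro expands_power_stationary[OF id]) simp
  have "\<forall>\<^sub>F z in F. poly Q (lat z) / lat z ^ 3 = tot z * inverse (lat z / z) ^ 3"
    using nz(1) ev by eventually_elim (auto simp: field_simps)
  then have "expands F ?s (\<lambda>z. poly Q (lat z) / lat z ^ 3) (C0 * 2 ^ 3) (C1 * 2 ^ 3)"
    by (rule expands_cong[THEN iffD2]) (use mult[OF tot irl] in simp)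
  then have "expands F lat (\<lambda>z. poly Q (lat z) / lat z ^ 3) (C0 * 2 ^ 3) (1 / 2 * (C1 * 2 ^ 3))"
    by (rule expands_rescale[OF id expands_imp_tendsto[OF id rl]])
  from expands_poly_coeff(2)[OF F(1) lat _ this] have "coeff Q (3 - 1) = 1 / 2 * (C1 * 2 ^ 3)"
    by simp
  then have Q2: "coeff Q 2 = 4 * C1" by simp
  have ring: "2 * (N * (- X - 2 * d * s * e * b) + M * (- Y + 2 * d * s)) =
      - 4 * d * (N * (e * b) - M) * s - 2 * (N * X + M * Y)" for X Y d s e b M :: complex
    by (simp add: algebra_simps)
  have "4 * (a / 2 * (N / a * X + inverse N / a * Y)) = 2 * (N * X + inverse N * Y)"
    if "a \<noteq> 0" for a X Y :: complex
    using that by (simp add: field_simps)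
  then have "4 * C1 = 2 *
      (N * (- (\<beta>\<^sup>2 * e3 + e4 * \<beta> * (\<tau> + inverse \<tau>)) - 2 * (qh - inverse qh) * ?\<pi> * e4 * \<beta>\<^sup>2)
      + inverse N * (- (e1 + \<beta> * (\<tau> + inverse \<tau>)) + 2 * (qh - inverse qh) * ?\<pi>))"
    unfolding C1_def using an(1) by blast
  also have "\<dots> = - 4 * (qh - inverse qh) * (N * (e4 * \<beta>\<^sup>2) - inverse N) * ?\<pi>
      - 2 * (N * (\<beta>\<^sup>2 * e3 + e4 * \<beta> * (\<tau> + inverse \<tau>)) + inverse N * (e1 + \<beta> * (\<tau> + inverse \<tau>)))"
    by (rule ring)
  finally show ?thesis using Q2 unfolding Q_def by simp
qed

end

section \<open>Product formulas for the data polynomials\<close>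

text \<open>Each product is symmetric under inversion of \<open>z\<close>, hence affine in x =
  \<open>lat z\<close>.\<close>

lemma deformation_values:
  assumes "deformation_data qh \<alpha> t R S" "z \<noteq> 0" "t \<noteq> 0"
  shows "poly R (lat z) + lat_delta qh t * poly S (lat z) = 1 + (\<alpha> / qh * t)\<^sup>2 - 2 * (\<alpha> / qh * t) * lat z"
    and "poly R (lat z) - lat_delta qh t * poly S (lat z) = 1 + (\<alpha> / qh / t)\<^sup>2 - 2 * (\<alpha> / qh / t) * lat z"
proof -
  have *: "(1 - b * z) * (1 - b * inverse z) = 1 + b\<^sup>2 - 2 * b * lat z" for b
    using assms(2) by (simp add: lat_def field_simps power2_eq_square)
  show "poly R (lat z) + lat_delta qh t * poly S (lat z) = 1 + (\<alpha> / qh * t)\<^sup>2 - 2 * (\<alpha> / qh * t) * lat z"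
    and "poly R (lat z) - lat_delta qh t * poly S (lat z) = 1 + (\<alpha> / qh / t)\<^sup>2 - 2 * (\<alpha> / qh / t) * lat z"
    using assms *[of "\<alpha> / qh * t"] *[of "\<alpha> / qh / t"]
    by (simp_all add: deformation_data_def divide_inverse)
qed

text \<open>The first-order coefficients stay existential: they do not involve \<open>t\<close> and
  cancel in the difference of \<open>w2\<close> at v_+ and v_-.\<close>

lemma expands_prod4_ex:
  fixes b :: "nat \<Rightarrow> complex"
  assumes id: "filterlim s at_infinity F"
  shows "\<exists>e. expands F s (\<lambda>z. \<Prod>j=1..4. inverse (s z) - b j) (b 1 * b 2 * b 3 * b 4) (- e)"
    and "\<exists>e. expands F s (\<lambda>z. \<Prod>j=1..4. 1 - b j * inverse (s z)) 1 (- e)"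
proof -
  note mult = expands_mult[OF id] and inv = expands_inverse_scale[OF id]
  have four: "{1..4::nat} = {1, 2, 3, 4}" by auto
  have t: "expands F s (\<lambda>z. inverse (s z) - b j) (- b j) 1" for j
    using expands_diff[OF inv expands_const[of F s "b j"]] by simp
  have m: "expands F s (\<lambda>z. 1 - b j * inverse (s z)) 1 (- b j)" for j
    using expands_diff[OF expands_const[of F s 1] expands_cmult[OF inv, of "b j"]] by simp
  from mult[OF t[of 1] mult[OF t[of 2] mult[OF t[of 3] t[of 4]]]]
  show "\<exists>e. expands F s (\<lambda>z. \<Prod>j=1..4. inverse (s z) - b j) (b 1 * b 2 * b 3 * b 4) (- e)"
    unfolding four by (intro exI[of _ "- c" for c]) (simp add: mult_ac)
  from mult[OF m[of 1] mult[OF m[of 2] mult[OF m[of 3] m[of 4]]]]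
  show "\<exists>e. expands F s (\<lambda>z. \<Prod>j=1..4. 1 - b j * inverse (s z)) 1 (- e)"
    unfolding four by (intro exI[of _ "- c" for c]) (simp add: mult_ac)
qed

section \<open>The deformation coefficients\<close>

text \<open>The shift acts on u only, so all functions are taken at the same x and the expansions
  are directly in 1/x. The products p_n q_(n-1) determine r_1 and r_0; for p_+ and p_- the leading
  terms suffice.\<close>

lemma deformation_coeffs_asymptotics:
  fixes G :: support and t :: complex
  assumes n: "n \<ge> 1" and t: "t \<noteq> 0" and q: "qh \<noteq> 0"
    and F: "F \<noteq> bot" "F \<le> at_infinity" and c: "c > 0"
    and sep: "\<forall>\<^sub>F z in F. separated c (support_points qh G) (lat_plus qh z)"
    and orthp: "orthonormal_upto qh G \<omega> p n (lat_plus qh t)"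
    and orthm: "orthonormal_upto qh G \<omega> p n (lat_minus qh t)"
    and data: "deformation_data qh \<alpha> t R S"
    and coeffs: "deformation_coeffs qh G \<omega> p n t R S r1p r0p r1m r0m pp pm"
  defines "\<beta> \<equiv> \<alpha> / qh" and "A \<equiv> rec_coeff p n (lat t)"
    and "gp \<equiv> lead_coeff (p n (lat_plus qh t))" and "gm \<equiv> lead_coeff (p n (lat_minus qh t))"
    and "hp \<equiv> lead_coeff (p (n - 1) (lat_plus qh t))" and "hm \<equiv> lead_coeff (p (n - 1) (lat_minus qh t))"
    and "sp \<equiv> coeff (p n (lat_plus qh t)) (n - 1) / lead_coeff (p n (lat_plus qh t))"
    and "sm \<equiv> coeff (p n (lat_minus qh t)) (n - 1) / lead_coeff (p n (lat_minus qh t))"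
  shows "r1p = A * (2 * (\<beta> * t) * gp / hm)"
    and "r0p = r1p * (sp - sm) - A * (1 + (\<beta> * t)\<^sup>2) * gp / hm"
    and "r1m = A * (2 * (\<beta> / t) * gm / hp)"
    and "r0m = r1m * (sm - sp) - A * (1 + (\<beta> / t)\<^sup>2) * gm / hp"
    and "pp = A * (2 * (\<beta> * t) * gp / gm - 2 * (\<beta> / t) * gm / gp)"
    and "pm = A * (2 * (\<beta> * t) * hp / hm - 2 * (\<beta> / t) * hm / hp)"
proof -
  define vp vm where "vp = lat_plus qh t" and "vm = lat_minus qh t"
  \<comment> \<open>The point x runs through y_+, a path to infinity on which \<open>F\<close> keeps
    it away from the support.\<close>
  define X where "X = lat_plus qh"
  interpret P: orthonormal_polys qh G \<omega> p n vp using orthp by unfold_locales (simp add: vp_def)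
  interpret M: orthonormal_polys qh G \<omega> p n vm using orthm by unfold_locales (simp add: vm_def)
  have id: "filterlim (\<lambda>z::complex. z) at_infinity F" using F(2) by (simp add: filterlim_def)
  have X: "filterlim X at_infinity F"
    unfolding X_def lat_plus_def by (intro filterlim_lat_at_infinity filterlim_cmult_at_infinity q id)
  note sep' = sep[folded X_def]
  note mult = expands_mult[OF X] and inv = expands_inverse_scale[OF X]
  have g: "gp \<noteq> 0" "gm \<noteq> 0" "hp \<noteq> 0" "hm \<noteq> 0"
    using P.lead_nonzero[of n] M.lead_nonzero[of n] P.lead_nonzero[of "n - 1"] M.lead_nonzero[of "n - 1"]
    by (simp_all add: gp_def gm_def hp_def hm_def vp_def vm_def)
  \<comment> \<open>These are R \<plusminus> \<Delta>v S divided by x.\<close>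
  define Rp Rm where
    "Rp = (\<lambda>z. (1 + (\<beta> * t)\<^sup>2) * inverse (X z) - 2 * (\<beta> * t))" and
    "Rm = (\<lambda>z. (1 + (\<beta> / t)\<^sup>2) * inverse (X z) - 2 * (\<beta> / t))"
  have Rp: "expands F X Rp (- (2 * (\<beta> * t))) (1 + (\<beta> * t)\<^sup>2)"
    and Rm: "expands F X Rm (- (2 * (\<beta> / t))) (1 + (\<beta> / t)\<^sup>2)"
    unfolding Rp_def Rm_def
    using expands_diff[OF expands_cmult[OF inv] expands_const[of F X "2 * (\<beta> * t)"], of "1 + (\<beta> * t)\<^sup>2"]
      expands_diff[OF expands_cmult[OF inv] expands_const[of F X "2 * (\<beta> / t)"], of "1 + (\<beta> / t)\<^sup>2"]
    by simp_all
  define q1 where "q1 k v z = X z ^ (k + 1) * second_kind qh G \<omega> p k (X z) v" for k v z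
  define p1 where "p1 k v z = poly (p k v) (X z) / X z ^ k" for k v z
  have pnp: "expands F X (p1 n vp) gp (gp * sp)" and pnm: "expands F X (p1 n vm) gm (gm * sm)"
    using P.expands_p[OF X n order_refl] M.expands_p[OF X n order_refl] g
    by (simp_all add: gp_def gm_def sp_def sm_def vp_def vm_def p1_def[abs_def])
  obtain c1 where p'p: "expands F X (p1 (n - 1) vp) hp c1"
    using P.expands_p_ex[OF X diff_le_self] unfolding hp_def vp_def p1_def[abs_def] by blast
  obtain c2 where p'm: "expands F X (p1 (n - 1) vm) hm c2"
    using M.expands_p_ex[OF X diff_le_self] unfolding hm_def vm_def p1_def[abs_def] by blast
  obtain d1 where qnp: "expands F X (q1 n vp) (1 / gp) d1"
    using P.expands_second_kind[OF order_refl c X sep'] unfolding gp_def vp_def q1_def[abs_def] by blast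
  obtain d2 where qnm: "expands F X (q1 n vm) (1 / gm) d2"
    using M.expands_second_kind[OF order_refl c X sep'] unfolding gm_def vm_def q1_def[abs_def] by blast
  have q'p: "expands F X (q1 (n - 1) vp) (1 / hp) (- (sp / hp))"
    using P.expands_second_kind_pred[OF n c X sep'] unfolding q1_def[abs_def] hp_def sp_def vp_def .
  have q'm: "expands F X (q1 (n - 1) vm) (1 / hm) (- (sm / hm))"
    using M.expands_second_kind_pred[OF n c X sep'] unfolding q1_def[abs_def] hm_def sm_def vm_def .
  let ?i = "\<lambda>z. inverse (X z) * inverse (X z)"
  \<comment> \<open>The equations for \<open>r1p\<close>, \<open>r0p\<close>, \<open>r1m\<close>,
    \<open>r0m\<close> are divided by x. The terms with p_(n-1) q_n carry x^-2 and drop out at this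
    order.\<close>
  have ev: "\<forall>\<^sub>F x in F. r1p + r0p * inverse (X x) = A * (Rm x * (p1 (n - 1) vm x * q1 n vp x * ?i x) - Rp x * (p1 n vp x * q1 (n - 1) vm x)) \<and>
      r1m + r0m * inverse (X x) = A * (Rp x * (p1 (n - 1) vp x * q1 n vm x * ?i x) - Rm x * (p1 n vm x * q1 (n - 1) vp x)) \<and>
      pp = A * (Rm x * (p1 n vm x * q1 n vp x) - Rp x * (p1 n vp x * q1 n vm x)) \<and>
      pm = A * (Rm x * (p1 (n - 1) vm x * q1 (n - 1) vp x) - Rp x * (p1 (n - 1) vp x * q1 (n - 1) vm x))"
    using eventually_compose_filterlim[OF coeffs[unfolded deformation_coeffs_def Let_def] X]
      filterlim_at_infinity_imp_eventually_ne[OF X, of 0]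
      filterlim_at_infinity_imp_eventually_ne[OF id, of 0] sep'
  proof eventually_elim
    case (elim z)
    define x where "x = X z"
    have x: "x \<noteq> 0" using elim(2) by (simp add: x_def)
    have lat: "x = lat (qh * z)" "qh * z \<noteq> 0" using q elim(3) by (simp_all add: x_def X_def lat_plus_def)
    have canc: "x * (a * inverse (X z) - b) = a - b * x" for a b
      using x by (simp add: x_def field_simps)
    have Rp': "poly R x + lat_delta qh t * poly S x = x * Rp z"
      and Rm': "poly R x - lat_delta qh t * poly S x = x * Rm z"
      unfolding Rp_def Rm_def canc
      by (rule deformation_values[OF data lat(2) t, folded lat(1), folded \<beta>_def])+
    have notin: "x \<notin> support_points qh G" using separated_notin[OF elim(4) c elim(2)] by (simp add: x_def)
    obtain m where m: "n = Suc m" using n by (cases n) auto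
    define Pp Pm Pp' Pm' Qp Qm Qp' Qm' where
      "Pp = p1 n vp z" and "Pm = p1 n vm z" and "Pp' = p1 (n - 1) vp z" and "Pm' = p1 (n - 1) vm z" and
      "Qp = q1 n vp z" and "Qm = q1 n vm z" and "Qp' = q1 (n - 1) vp z" and "Qm' = q1 (n - 1) vm z"
    have poly: "poly (p n vp) x = x ^ n * Pp" "poly (p n vm) x = x ^ n * Pm"
      "poly (p (n - 1) vp) x = x ^ (n - 1) * Pp'" "poly (p (n - 1) vm) x = x ^ (n - 1) * Pm'"
      using x by (simp_all add: Pp_def Pm_def Pp'_def Pm'_def p1_def x_def[symmetric])
    have sk: "second_kind qh G \<omega> p n x vp = Qp / x ^ (n + 1)" "second_kind qh G \<omega> p n x vm = Qm / x ^ (n + 1)"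
      "second_kind qh G \<omega> p (n - 1) x vp = Qp' / x ^ (n - 1 + 1)" "second_kind qh G \<omega> p (n - 1) x vm = Qm' / x ^ (n - 1 + 1)"
      using x by (simp_all add: Qp_def Qm_def Qp'_def Qm'_def q1_def x_def[symmetric])
    note eqs = elim(1)[folded x_def vp_def vm_def A_def, rule_format, OF notin, unfolded Rp' Rm' poly sk]
    have "r1p * x + r0p = A * (- (x * Rp z) * (x ^ n * Pp) * (Qm' / x ^ (n - 1 + 1)) + x * Rm z * (x ^ (n - 1) * Pm') * (Qp / x ^ (n + 1)))"
      using eqs by simp
    also have "\<dots> = x * (A * (Rm z * (Pm' * Qp * (inverse x * inverse x)) - Rp z * (Pp * Qm')))"
      using x by (simp add: m field_simps)
    finally have 1: "r1p + r0p * inverse x = A * (Rm z * (Pm' * Qp * (inverse x * inverse x)) - Rp z * (Pp * Qm'))"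
      using x by (simp add: field_simps)
    have "r1m * x + r0m = A * (x * Rp z * (x ^ (n - 1) * Pp') * (Qm / x ^ (n + 1)) - x * Rm z * (x ^ n * Pm) * (Qp' / x ^ (n - 1 + 1)))"
      using eqs by simp
    also have "\<dots> = x * (A * (Rp z * (Pp' * Qm * (inverse x * inverse x)) - Rm z * (Pm * Qp')))"
      using x by (simp add: m field_simps)
    finally have 2: "r1m + r0m * inverse x = A * (Rp z * (Pp' * Qm * (inverse x * inverse x)) - Rm z * (Pm * Qp'))"
      using x by (simp add: field_simps)
    have "pp = - A * (x * Rp z * (x ^ n * Pp) * (Qm / x ^ (n + 1)) - x * Rm z * (x ^ n * Pm) * (Qp / x ^ (n + 1)))"
      using eqs by simp
    also have "\<dots> = A * (Rm z * (Pm * Qp) - Rp z * (Pp * Qm))"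
      using x by (simp add: field_simps)
    finally have 3: "pp = A * (Rm z * (Pm * Qp) - Rp z * (Pp * Qm))" .
    have "pm = A * (- (x * Rp z) * (x ^ (n - 1) * Pp') * (Qm' / x ^ (n - 1 + 1)) + x * Rm z * (x ^ (n - 1) * Pm') * (Qp' / x ^ (n - 1 + 1)))"
      using eqs by simp
    also have "\<dots> = A * (Rm z * (Pm' * Qp') - Rp z * (Pp' * Qm'))"
      using x by (simp add: field_simps)
    finally have 4: "pm = A * (Rm z * (Pm' * Qp') - Rp z * (Pp' * Qm'))" .
    show ?case
      using 1 2 3 4 unfolding Pp_def Pm_def Pp'_def Pm'_def Qp_def Qm_def Qp'_def Qm'_def x_def by blast
  qed
  note e1 = expands_cmult[OF expands_diff[OF mult[OF Rm mult[OF mult[OF p'm qnp] mult[OF inv inv]]]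
      mult[OF Rp mult[OF pnp q'm]]], of A]
  note e2 = expands_cmult[OF expands_diff[OF mult[OF Rp mult[OF mult[OF p'p qnm] mult[OF inv inv]]]
      mult[OF Rm mult[OF pnm q'p]]], of A]
  note e3 = expands_cmult[OF expands_diff[OF mult[OF Rm mult[OF pnm qnp]] mult[OF Rp mult[OF pnp qnm]]], of A]
  note e4 = expands_cmult[OF expands_diff[OF mult[OF Rm mult[OF p'm q'p]] mult[OF Rp mult[OF p'p q'm]]], of A]
  have lin: "expands F X (\<lambda>x. a + b * inverse (X x)) a b" for a b
    using expands_add[OF expands_const[of F X a] expands_cmult[OF inv, of b]] by simp
  note ev' = ev[unfolded eventually_conj_iff]
  note uniq = expands_unique[OF F(1) X]
  show r1p: "r1p = A * (2 * (\<beta> * t) * gp / hm)"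
    and "r0p = r1p * (sp - sm) - A * (1 + (\<beta> * t)\<^sup>2) * gp / hm"
  proof -
    note e' = expands_cong[THEN iffD2, OF conjunct1[OF ev'] e1]
    note u = uniq[OF lin e']
    show r1p: "r1p = A * (2 * (\<beta> * t) * gp / hm)" using u(1) by simp
    show "r0p = r1p * (sp - sm) - A * (1 + (\<beta> * t)\<^sup>2) * gp / hm"
      unfolding u(2) r1p using g t by (simp add: field_simps)
  qed
  show r1m: "r1m = A * (2 * (\<beta> / t) * gm / hp)"
    and "r0m = r1m * (sm - sp) - A * (1 + (\<beta> / t)\<^sup>2) * gm / hp"
  proof -
    note e' = expands_cong[THEN iffD2, OF conjunct1[OF conjunct2[OF ev']] e2]
    note u = uniq[OF lin e']
    show r1m: "r1m = A * (2 * (\<beta> / t) * gm / hp)" using u(1) by simp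
    show "r0m = r1m * (sm - sp) - A * (1 + (\<beta> / t)\<^sup>2) * gm / hp"
      unfolding u(2) r1m using g t by (simp add: field_simps)
  qed
  show "pp = A * (2 * (\<beta> * t) * gp / gm - 2 * (\<beta> / t) * gm / gp)"
  proof -
    note e' = expands_cong[THEN iffD2, OF conjunct1[OF conjunct2[OF conjunct2[OF ev']]] e3]
    from uniq(1)[OF expands_const e'] show ?thesis by simp
  qed
  show "pm = A * (2 * (\<beta> * t) * hp / hm - 2 * (\<beta> / t) * hm / hp)"
  proof -
    note e' = expands_cong[THEN iffD2, OF conjunct2[OF conjunct2[OF conjunct2[OF ev']]] e4]
    from uniq(1)[OF expands_const e'] show ?thesis by simp
  qed
qed

section \<open>Elimination of the subleading coefficients\<close>

text \<open>In its use \<open>K = e4 * \<beta>\<close>, so \<open>K * \<beta>\<close> is \<sigma>_6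
  and \<open>B\<close> is [n]; \<open>s\<close> is the difference of the subleading coefficients.
  The mixed terms cancel and everything left has the factor \<open>B\<close>. With \<open>t\<close>
  free, the instance at \<open>inverse t\<close> serves \<open>r0m\<close>.\<close>

lemma subleading_identity:
  fixes r B d N M K \<beta> t s :: complex
  assumes "d \<noteq> 0" "B \<noteq> 0" "\<beta> \<noteq> 0" "t \<noteq> 0" and B: "B = N * (K * \<beta>) - M"
  shows "r / (4 * d * B) * (4 * d * B * s + 2 * (N * K + M * \<beta>) * d * (t - inverse t)
      - 2 * d * (\<beta> + inverse \<beta>) * (K * \<beta> * N * t - M * inverse t)) =
    r * s - r * (1 + (\<beta> * t)\<^sup>2) / (2 * (\<beta> * t))"
proof -
  have e1: "(N * K + M * \<beta>) * (t - inverse t) - (\<beta> + inverse \<beta>) * (K * \<beta> * N * t - M * inverse t) =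
      - (\<beta> * t + inverse (\<beta> * t)) * B"
    using assms(3,4) unfolding B by (simp add: field_simps)
  have e2: "4 * d * B * s + 2 * (N * K + M * \<beta>) * d * (t - inverse t)
      - 2 * d * (\<beta> + inverse \<beta>) * (K * \<beta> * N * t - M * inverse t) = 4 * d * B * s + 2 * d *
      ((N * K + M * \<beta>) * (t - inverse t) - (\<beta> + inverse \<beta>) * (K * \<beta> * N * t - M * inverse t))"
    by (simp add: algebra_simps)
  have "4 * d * B * s + 2 * d * (- y * B) = 4 * d * B * (s - y / 2)" for y
    by (simp add: algebra_simps)
  then have e3: "4 * d * B * s + 2 * (N * K + M * \<beta>) * d * (t - inverse t)
      - 2 * d * (\<beta> + inverse \<beta>) * (K * \<beta> * N * t - M * inverse t) =
      4 * d * B * (s - (\<beta> * t + inverse (\<beta> * t)) / 2)"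
    unfolding e2 e1 .
  have e4: "r / (4 * d * B) * (4 * d * B * y) = r * y" for y
    using assms(1,2) by simp
  have e5: "(\<beta> * t + inverse (\<beta> * t)) / 2 = (1 + (\<beta> * t)\<^sup>2) / (2 * (\<beta> * t))"
    using assms(3,4) by (simp add: field_simps power2_eq_square)
  show ?thesis unfolding e3 e4 e5 by (simp add: right_diff_distrib)
qed

theorem proposition7p8:
  fixes qh \<alpha> t :: complex
    and a :: "nat \<Rightarrow> complex"
    and G :: support
    and \<omega> :: "complex \<Rightarrow> complex \<Rightarrow> complex"
    and p :: "nat \<Rightarrow> complex \<Rightarrow> complex poly"
    and W V Wn \<Omega>n :: "complex \<Rightarrow> complex poly"
    and R S :: "complex poly"
    and r1p r0p r1m r0m pp pm :: complex
    and n :: nat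
  assumes n: "n \<ge> 1"
    and q: "qh \<noteq> 0" "qh\<^sup>2 \<noteq> 1"
    and a: "\<forall>j\<in>{1..4}. norm (a j / qh) \<noteq> 1"
    and \<alpha>: "norm (\<alpha> / qh) \<noteq> 1" "\<alpha> \<noteq> 0" "\<alpha> \<noteq> qh" "\<alpha> \<noteq> - qh"
    and t: "t \<noteq> 0" "t \<noteq> 1" "t \<noteq> -1"
    and bracket: "bracket qh (param_esym qh a \<alpha> t 6) (2 * n) \<noteq> 0"
      "bracket qh (param_esym qh a \<alpha> t 6) (2 * n + 1) \<noteq> 0"
    and G: "support_ok G"
    and spectral: "\<forall>\<tau>\<in>{t, qh * t, t / qh}.
      spectral_data qh a \<alpha> \<tau> (W (lat \<tau>)) (V (lat \<tau>)) \<and>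
      pearson_x qh \<omega> (lat \<tau>) (W (lat \<tau>)) (V (lat \<tau>)) \<and>
      stieltjes_eq_x qh G \<omega> (lat \<tau>) (W (lat \<tau>)) (V (lat \<tau>)) \<and>
      orthonormal_upto qh G \<omega> p n (lat \<tau>) \<and>
      spectral_coeffs qh G \<omega> p n (lat \<tau>)
        (W (lat \<tau>)) (V (lat \<tau>)) (Wn (lat \<tau>)) (\<Omega>n (lat \<tau>))"
    and deformation: "deformation_data qh \<alpha> t R S"
      "pearson_u qh \<omega> t R S"
      "stieltjes_eq_u qh G \<omega> t R S"
      "deformation_coeffs qh G \<omega> p n t R S r1p r0p r1m r0m pp pm"
  shows "let vp = lat_plus qh t; vm = lat_minus qh t; \<sigma>\<^sub>6 = param_esym qh a \<alpha> t 6;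
             d = qh - inverse qh; q = qh\<^sup>2; an = rec_coeff p n; w = w2 Wn W
         in pp = r1p * an vm - r1m * an vp \<and>
            pm = r1p * an vp - r1m * an vm \<and>
            r0p = r1p / (4 * d * bracket qh \<sigma>\<^sub>6 (2 * n)) *
              (- w vp + w vm
               - 2 * d * (\<alpha> / qh + qh / \<alpha>) * (\<sigma>\<^sub>6 * q ^ n * t - inverse (q ^ n) * inverse t)) \<and>
            r0m = r1m / (4 * d * bracket qh \<sigma>\<^sub>6 (2 * n)) *
              (w vp - w vm
               - 2 * d * (\<alpha> / qh + qh / \<alpha>) * (\<sigma>\<^sub>6 * q ^ n * inverse t - inverse (q ^ n) * t))"
proof -
  define \<beta> where "\<beta> = \<alpha> / qh"
  define N where "N = (qh\<^sup>2) ^ n"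
  define d where "d = qh - inverse qh"
  define B where "B = bracket qh (param_esym qh a \<alpha> t 6) (2 * n)"
  define vp vm where "vp = lat_plus qh t" and "vm = lat_minus qh t"
  define A where "A = rec_coeff p n (lat t)"
  define gp gm hp hm where "gp = lead_coeff (p n vp)" and "gm = lead_coeff (p n vm)"
    and "hp = lead_coeff (p (n - 1) vp)" and "hm = lead_coeff (p (n - 1) vm)"
  define sp sm where "sp = coeff (p n vp) (n - 1) / gp" and "sm = coeff (p n vm) (n - 1) / gm"
  \<comment> \<open>The support does not depend on u, so a single filter serves v_+ and v_- and
    yields the same \<open>e1\<close> and \<open>e3\<close> for both.\<close>
  obtain F c where F: "F \<noteq> bot" "F \<le> at_infinity" and c: "c > 0"
    and sepp: "\<forall>\<^sub>F z in F. separated c (support_points qh G) (lat_plus qh z)"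
    and sepm: "\<forall>\<^sub>F z in F. separated c (support_points qh G) (lat_minus qh z)"
    using ex_separating_filter[OF G q(1)] by metis
  have id: "filterlim (\<lambda>z::complex. z) at_infinity F" using F(2) by (simp add: filterlim_def)
  define e4 where "e4 = (a 1 / qh) * (a 2 / qh) * (a 3 / qh) * (a 4 / qh)"
  obtain e3 e1 where e3: "expands F (\<lambda>z. z) (\<lambda>z. \<Prod>j=1..4. inverse z - a j / qh) e4 (- e3)"
    and e1: "expands F (\<lambda>z. z) (\<lambda>z. \<Prod>j=1..4. 1 - a j / qh * inverse z) 1 (- e1)"
    using expands_prod4_ex[OF id, of "\<lambda>j. a j / qh"] unfolding e4_def by auto
  have vp: "vp = lat (qh * t)" and vm: "vm = lat (t / qh)"
    by (simp_all add: vp_def vm_def lat_plus_def lat_minus_def)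
  \<comment> \<open>The two moving parameters over \<open>qh\<close> multiply to
    \<open>\<beta> * \<beta>\<close>, so \<open>t\<close> disappears.\<close>
  have sigma: "param_esym qh a \<alpha> t 6 = e4 * \<beta> * \<beta>"
    unfolding param_esym_6[OF t(1)] e4_def \<beta>_def
    using q(1) by (simp add: field_simps power2_eq_square power_eq_if)
  have \<beta>0: "\<beta> \<noteq> 0" and d0: "d \<noteq> 0" and B0: "B \<noteq> 0"
    using \<alpha>(2) q bracket(1) by (auto simp: \<beta>_def d_def B_def field_simps power2_eq_square)
  have B: "B = N * (e4 * \<beta> * \<beta>) - inverse N"
    by (simp add: B_def sigma bracket_def N_def power_mult)
  interpret P: orthonormal_polys qh G \<omega> p n vp using spectral by unfold_locales (simp add: vp)
  interpret M: orthonormal_polys qh G \<omega> p n vm using spectral by unfold_locales (simp add: vm)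
  have g: "gp \<noteq> 0" "gm \<noteq> 0" "hp \<noteq> 0" "hm \<noteq> 0"
    using P.lead_nonzero[of n] M.lead_nonzero[of n] P.lead_nonzero[of "n - 1"] M.lead_nonzero[of "n - 1"]
    by (simp_all add: gp_def gm_def hp_def hm_def)
  have wp: "w2 Wn W vp = - 4 * d * B * sp
      - 2 * (N * (\<beta>\<^sup>2 * e3 + e4 * \<beta> * (qh * t + inverse (qh * t))) + inverse N * (e1 + \<beta> * (qh * t + inverse (qh * t))))"
    using P.coeff_2_spectral[OF n q(1) _ F c sepp sepm _ _ e3 e1, of "qh * t" \<alpha> "W vp" "V vp" "Wn vp" "\<Omega>n vp"]
      spectral q(1) t(1)
    by (simp add: w2_def vp B d_def N_def \<beta>_def sp_def gp_def power2_eq_square mult.assoc)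
  have wm: "w2 Wn W vm = - 4 * d * B * sm
      - 2 * (N * (\<beta>\<^sup>2 * e3 + e4 * \<beta> * (t / qh + inverse (t / qh))) + inverse N * (e1 + \<beta> * (t / qh + inverse (t / qh))))"
    using M.coeff_2_spectral[OF n q(1) _ F c sepp sepm _ _ e3 e1, of "t / qh" \<alpha> "W vm" "V vm" "Wn vm" "\<Omega>n vm"]
      spectral q(1) t(1)
    by (simp add: w2_def vm B d_def N_def \<beta>_def sm_def gm_def power2_eq_square mult.assoc)
  \<comment> \<open>This is twice v_+ - v_-, the only \<open>t\<close>-dependence of \<sigma>_1 and
    \<sigma>_5 that survives in the difference of \<open>w2\<close>.\<close>
  have shift: "qh * t + inverse (qh * t) = t / qh + inverse (t / qh) + d * (t - inverse t)"
    using q(1) t(1) by (simp add: d_def field_simps)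
  have w: "- w2 Wn W vp + w2 Wn W vm =
      4 * d * B * (sp - sm) + 2 * (N * (e4 * \<beta>) + inverse N * \<beta>) * d * (t - inverse t)"
    unfolding wp wm shift by (simp add: algebra_simps)
  \<comment> \<open>The negative of \<open>w\<close>, written with \<open>inverse t\<close> in the
    role of \<open>t\<close> so that \<open>subleading_identity\<close> applies to it.\<close>
  have w': "w2 Wn W vp - w2 Wn W vm =
      4 * d * B * (sm - sp) + 2 * (N * (e4 * \<beta>) + inverse N * \<beta>) * d * (inverse t - inverse (inverse t))"
    unfolding wp wm shift by (simp add: algebra_simps)
  note val = deformation_coeffs_asymptotics[OF n t(1) q(1) F c sepp P.orth[unfolded vp_def] M.orth[unfolded vm_def]
      deformation(1,4), folded vp_def vm_def \<beta>_def, folded A_def gp_def gm_def hp_def hm_def, folded sp_def sm_def]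
  have an: "rec_coeff p n vp = hp / gp" "rec_coeff p n vm = hm / gm"
    by (simp_all add: rec_coeff_def gp_def gm_def hp_def hm_def)
  \<comment> \<open>The factors \<open>hp\<close> and \<open>hm\<close> in \<open>r1p\<close> and
    \<open>r1m\<close> combine with the recurrence coefficients \<open>hp / gp\<close> and
    \<open>hm / gm\<close>.\<close>
  have pp: "pp = r1p * rec_coeff p n vm - r1m * rec_coeff p n vp"
    and pm: "pm = r1p * rec_coeff p n vp - r1m * rec_coeff p n vm"
    unfolding val(1,3,5,6) an using g by (simp_all add: field_simps)
  have inv_\<beta>: "qh / \<alpha> = inverse \<beta>" by (simp add: \<beta>_def)
  \<comment> \<open>By the formula for \<open>r1p\<close>, the last term of \<open>val(2)\<close> is
    \<open>r1p\<close> times \<open>(1 + (\<beta> * t)\<^sup>2) / (2 * (\<beta> * t))\<close>, as in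
    \<open>subleading_identity\<close>.\<close>
  have r0p: "r0p = r1p / (4 * d * B) * (- w2 Wn W vp + w2 Wn W vm
      - 2 * d * (\<beta> + inverse \<beta>) * (e4 * \<beta> * \<beta> * N * t - inverse N * inverse t))"
    unfolding w subleading_identity[OF d0 B0 \<beta>0 t(1) B] val(2)
    unfolding val(1) using g t(1) \<beta>0 by (simp add: field_simps)
  have r0m: "r0m = r1m / (4 * d * B) * (w2 Wn W vp - w2 Wn W vm
      - 2 * d * (\<beta> + inverse \<beta>) * (e4 * \<beta> * \<beta> * N * inverse t - inverse N * inverse (inverse t)))"
    unfolding w' subleading_identity[OF d0 B0 \<beta>0 nonzero_imp_inverse_nonzero[OF t(1)] B] val(4)
    unfolding val(3) using g t(1) \<beta>0 by (simp add: field_simps)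
  show ?thesis
    unfolding Let_def
    unfolding vp_def[symmetric] vm_def[symmetric] sigma B_def[unfolded sigma, symmetric]
      N_def[symmetric] d_def[symmetric] inv_\<beta> unfolding \<beta>_def[symmetric]
    using pp pm r0p r0m by simp
qed

end
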